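(* Let $\mathcal{U}\times\mathcal{V}\subseteq\mathbb{R}^n\times\mathbb{R}^m$ be an open neighborhood of the origin, and let $f:\mathcal{U}\times\mathcal{V}\to\mathbb{R}^n$ be of class $C^1$ with $f(0,0)=0$. Suppose $\mathcal{O}\subseteq\mathcal{U}\times\mathcal{V}$ is a neighborhood of the origin such that $\mathrm{cov} f(x,u)>0$ for all $(x,u)\in\mathcal{O}\setminus\{0\}$, and suppose $f$ satisfies a semitransversality condition on $\mathcal{O}$ (i.e. at every point of $\mathcal{O}$). Then $\dot{x}=f(x,u)$ is locally exponentially stabilizable by means of continuous stationary feedback laws which are differentiable on a punctured neighborhood of the origin.
   Context: All norms are Euclidean; $\mathbb{B}_r(z)$ is the closed ball of radius $r$ centered at $z$; $A^*$ is the transpose of a real matrix $A$; $\mathbb{P}_V$ is the orthogonal projection onto a subspace $V$. Linear openness: a mapping $g$ into $\mathbb{R}^n$ defined near $\bar z\in\mathbb{R}^\ell$ is linearly open around $\bar z$ with modulus $\kappa>0$ if there is a neighborhood $\mathcal{W}$ of $\bar z$ such that $\mathbb{B}_{\kappa r}(g(z))\subseteq g(\mathbb{B}_r(z))$ for all $z\in\mathcal{W}$ and $r>0$ with $\mathbb{B}_r(z)\subseteq\mathcal{W}$. $\mathrm{cov}\,g(\bar z)$ denotes the supremum of all such moduli $\kappa$, with $\mathrm{cov}\,g(\bar z):=0$ if $g$ is not linearly open around $\bar z$ for any modulus. For $(a,b)$ in the domain of $f$ write $A=\frac{\partial f}{\partial x}|_{(a,b)}$ (an $n\times n$ matrix)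 and $B=\frac{\partial f}{\partial u}|_{(a,b)}$ (an $n\times m$ matrix). $f$ satisfies a type I semitransversality condition at $(a,b)$ if there exists an $m\times n$ matrix $Q$ with $A=-BQ$. $f$ satisfies a type II semitransversality condition at $(a,b)$ if $\mathbb{P}_{\ker(B^* )^\perp}AA^*\mathbb{P}_{\ker(B^* )^\perp}=AA^*$. $f$ satisfies a semitransversality condition at $(a,b)$ if it satisfies a type I or a type II semitransversality condition there. The system $\dot x=f(x,u)$ is locally exponentially stabilizable by means of feedback laws of a given class if there exist a feedback $\bar u(x)$ of that class, defined near $0\in\mathbb{R}^n$, stationary in the sense that $\bar u(0)=0$, and constants $\alpha,M,\delta>0$ such that for every $x_0$ with $\|x_0\|<\delta$ there is a unique solution $\phi(t,x_0)$ of $\dot x=f(x,\bar u(x))$ with $\phi(0,x_0)=x_0$, and $\|\phi(t,x_0)\|\le M\|x_0\|e^{-\alpha t}$ for all $t\ge 0$. Here the class is: continuous near $0$ and differentiable on a punctured neighborhood of $0$. *)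

theory Defs
  imports "HOL-Analysis.Analysis"
begin

definition continuously_differentiable_on ::
    "('a::real_normed_vector \<Rightarrow> 'b::real_normed_vector) \<Rightarrow> 'a set \<Rightarrow> bool" where
  "continuously_differentiable_on f S \<longleftrightarrow>
     (\<exists>f' :: 'a \<Rightarrow> 'a \<Rightarrow>\<^sub>L 'b.
        (\<forall>z\<in>S. (f has_derivative blinfun_apply (f' z)) (at z)) \<and> continuous_on S f')"


section \<open>Linear openness and the covering modulus\<close>

text \<open>The set \<open>D\<close> is the domain of the mapping \<open>g\<close>, which HOL represents by a total function;
  requiring \<open>W \<subseteq> D\<close> prevents the values of \<open>g\<close> outside its domain from playing any role.\<close>

definition linearly_open_around ::
    "'a::metric_space set \<Rightarrow> ('a \<Rightarrow> 'b::metric_space) \<Rightarrow> 'a \<Rightarrow> real \<Rightarrow> bool" where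
  "linearly_open_around D g z0 \<kappa> \<longleftrightarrow>
     0 < \<kappa> \<and>
     (\<exists>W. z0 \<in> interior W \<and> W \<subseteq> D \<and>
        (\<forall>z\<in>W. \<forall>r>0. cball z r \<subseteq> W \<longrightarrow> cball (g z) (\<kappa> * r) \<subseteq> g ` cball z r))"

text \<open>The supremum is taken in \<^typ>\<open>ereal\<close>, as a general mapping may be linearly open with
  arbitrarily large moduli.\<close>

definition cov ::
    "'a::metric_space set \<Rightarrow> ('a \<Rightarrow> 'b::metric_space) \<Rightarrow> 'a \<Rightarrow> ereal" where
  "cov D g z0 =
     (if \<exists>\<kappa>. linearly_open_around D g z0 \<kappa>
      then (SUP \<kappa> \<in> {\<kappa>. linearly_open_around D g z0 \<kappa>}. ereal \<kappa>)
      else 0)"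


section \<open>Semitransversality\<close>

definition orth_proj :: "'a::euclidean_space set \<Rightarrow> 'a \<Rightarrow> 'a" where
  "orth_proj V x = (THE y. y \<in> V \<and> x - y \<in> V\<^sup>\<bottom>)"

lemma orth_proj_eqI:
  assumes "subspace V" "y \<in> V" "x - y \<in> V\<^sup>\<bottom>"
  shows "orth_proj V x = y"
  unfolding orth_proj_def
proof (rule the_equality)
  fix y' assume y': "y' \<in> V \<and> x - y' \<in> V\<^sup>\<bottom>"
  have "y - y' \<in> V"
    using assms y' by (simp add: subspace_diff)
  moreover have "y - y' \<in> V\<^sup>\<bottom>"
    using subspace_diff[OF subspace_orthogonal_comp, of "x - y'" V "x - y"] y' assms(3) by simp
  ultimately show "y' = y"
    by (auto simp: orthogonal_comp_def orthogonal_self)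
qed (use assms in auto)

lemma orth_proj_works:
  assumes "subspace V"
  shows "orth_proj V x \<in> V" "x - orth_proj V x \<in> V\<^sup>\<bottom>"
proof -
  obtain y z where "y \<in> V" "z \<in> V\<^sup>\<bottom>" "x = y + z"
    using subspace_sum_orthogonal_comp[OF assms] by (metis UNIV_I set_plus_elim)
  then show "orth_proj V x \<in> V" "x - orth_proj V x \<in> V\<^sup>\<bottom>"
    using orth_proj_eqI[OF assms, of y x] by auto
qed

definition ker :: "real^'m^'n \<Rightarrow> (real^'m) set" where
  "ker M = {v. M *v v = 0}"

definition jac_x :: "((real^'n) \<times> (real^'m) \<Rightarrow> real^'n) \<Rightarrow> (real^'n) \<times> (real^'m) \<Rightarrow> real^'n^'n" where
  "jac_x f = (\<lambda>(a, b). jacobian (\<lambda>x. f (x, b)) (at a))"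

definition jac_u :: "((real^'n) \<times> (real^'m) \<Rightarrow> real^'n) \<Rightarrow> (real^'n) \<times> (real^'m) \<Rightarrow> real^'m^'n" where
  "jac_u f = (\<lambda>(a, b). jacobian (\<lambda>u. f (a, u)) (at b))"

definition semitransversal_I ::
    "((real^'n) \<times> (real^'m) \<Rightarrow> real^'n) \<Rightarrow> (real^'n) \<times> (real^'m) \<Rightarrow> bool" where
  "semitransversal_I f z \<longleftrightarrow> (\<exists>Q :: real^'n^'m. jac_x f z = - (jac_u f z ** Q))"

definition semitransversal_II ::
    "((real^'n) \<times> (real^'m) \<Rightarrow> real^'n) \<Rightarrow> (real^'n) \<times> (real^'m) \<Rightarrow> bool" where
  "semitransversal_II f z \<longleftrightarrow>
     (let A = jac_x f z; B = jac_u f z;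
          P = matrix (orth_proj ((ker (transpose B))\<^sup>\<bottom>))
      in P ** A ** transpose A ** P = A ** transpose A)"

definition semitransversal ::
    "((real^'n) \<times> (real^'m) \<Rightarrow> real^'n) \<Rightarrow> (real^'n) \<times> (real^'m) \<Rightarrow> bool" where
  "semitransversal f z \<longleftrightarrow> semitransversal_I f z \<or> semitransversal_II f z"


section \<open>Local exponential stabilizability\<close>

definition solves_on ::
    "'x::real_normed_vector set \<Rightarrow> ('x \<Rightarrow> 'x) \<Rightarrow> real set \<Rightarrow> (real \<Rightarrow> 'x) \<Rightarrow> bool" where
  "solves_on N g I \<phi> \<longleftrightarrow>
     (\<forall>t\<in>I. \<phi> t \<in> N \<and> (\<phi> has_vector_derivative g (\<phi> t)) (at t within I))"

text \<open>Uniqueness means that every forward solution with the same initial value, on whatever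
  interval \<open>[0, T)\<close> it is defined, is a restriction of the global solution \<open>\<phi>\<close>.\<close>

definition locally_exp_stable :: "'x::real_normed_vector set \<Rightarrow> ('x \<Rightarrow> 'x) \<Rightarrow> bool" where
  "locally_exp_stable N g \<longleftrightarrow>
     (\<exists>\<alpha>>0. \<exists>M>0. \<exists>\<delta>>0. \<forall>x0. norm x0 < \<delta> \<longrightarrow>
        (\<exists>\<phi>. solves_on N g {0..} \<phi> \<and> \<phi> 0 = x0 \<and>
             (\<forall>T>0. \<forall>\<psi>. solves_on N g {0..<T} \<psi> \<and> \<psi> 0 = x0 \<longrightarrow> (\<forall>t\<in>{0..<T}. \<psi> t = \<phi> t)) \<and>
             (\<forall>t\<ge>0. norm (\<phi> t) \<le> M * norm x0 * exp (- \<alpha> * t))))"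

text \<open>Here \<open>D\<close> is the domain of \<open>f\<close>, the predicate \<open>\<C>\<close> is the admissible class of feedback laws,
  and \<open>N\<close> is the neighborhood of the origin on which the feedback law is defined.\<close>

definition locally_exp_stabilizable_by ::
    "(('x::real_normed_vector \<Rightarrow> 'u::real_normed_vector) \<Rightarrow> bool) \<Rightarrow>
     ('x \<times> 'u) set \<Rightarrow> ('x \<times> 'u \<Rightarrow> 'x) \<Rightarrow> bool" where
  "locally_exp_stabilizable_by \<C> D f \<longleftrightarrow>
     (\<exists>u N. \<C> u \<and> u 0 = 0 \<and> open N \<and> 0 \<in> N \<and> (\<forall>x\<in>N. (x, u x) \<in> D) \<and>
            locally_exp_stable N (\<lambda>x. f (x, u x)))"

definition continuous_punctured_differentiable ::
    "('x::real_normed_vector \<Rightarrow> 'u::real_normed_vector) \<Rightarrow> bool" where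
  "continuous_punctured_differentiable u \<longleftrightarrow>
     (\<forall>\<^sub>F x in nhds 0. isCont u x) \<and> (\<forall>\<^sub>F x in at 0. u differentiable (at x))"

end

theory Submission
  imports Defs
begin

text \<open>Both semitransversality conditions force the kernel of \<open>B\<^sup>*\<close> into the kernel of \<open>A\<^sup>*\<close>, and
  a positive covering modulus makes \<open>[A B]\<close> onto; hence \<open>B\<close> is onto at every point but the origin.
  The feedback is chosen so that \<open>f (x, u x) = - 3 L x\<close>, where \<open>L\<close> is a Lipschitz constant of \<open>f\<close>.

  To find \<open>u x\<close>, fix a unit vector \<open>e\<close> and lift the segment from \<open>(|x| e, f (|x| e, 0))\<close> to
  \<open>(x, - 3 L x)\<close> through the submersion \<open>(x, u) \<mapsto> (x, f (x, u))\<close>, starting at \<open>(|x| e, 0)\<close>.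
  The segment avoids the origin, where the submersion degenerates, so the lift cannot approach the
  origin; and its length is of order \<open>|x|\<close>, so the lift cannot cross a fixed spherical shell
  when \<open>x\<close> is small. Thus the lift exists and \<open>u x\<close> tends to \<open>0\<close>. As \<open>f\<close> is only \<open>C\<^sup>1\<close>, the lift is
  computed by damped Newton steps whose size depends continuously on \<open>x\<close>; the resulting continuous
  approximate section is then smoothed and corrected by a contraction.\<close>

section \<open>Linear algebra and selection lemmas\<close>

lemma norm_matrix_vector_mult_le:
  fixes M :: "real^'m^'n"
  shows "norm (M *v v) \<le> norm M * norm v"
proof -
  have "norm (M *v v) = L2_set (\<lambda>i. norm ((M *v v) $ i)) UNIV"
    by (simp add: norm_vec_def)
  also have "\<dots> \<le> L2_set (\<lambda>i. norm (M $ i) * norm v) UNIV"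
    by (intro L2_set_mono) (auto simp: matrix_vector_mul_component Cauchy_Schwarz_ineq2)
  also have "\<dots> = norm M * norm v"
    by (simp add: norm_vec_def L2_set_left_distrib)
  finally show ?thesis .
qed

lemma bounded_bilinear_matrix_vector_mult:
  "bounded_bilinear ((*v) :: real^'m^'n \<Rightarrow> real^'m \<Rightarrow> real^'n)"
proof
  show "\<exists>K. \<forall>M v. norm ((M :: real^'m^'n) *v v) \<le> norm M * norm v * K"
    using norm_matrix_vector_mult_le by (intro exI[of _ 1]) auto
qed (simp_all add: matrix_vector_mult_add_rdistrib matrix_vector_right_distrib
      scaleR_matrix_vector_assoc matrix_vector_mult_scaleR)

lemma continuous_on_matrix_mult:
  fixes A :: "'a::topological_space \<Rightarrow> real^'m^'n" and C :: "'a \<Rightarrow> real^'k^'m"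
  assumes "continuous_on S A" "continuous_on S C"
  shows "continuous_on S (\<lambda>z. A z ** C z)"
  unfolding matrix_matrix_mult_def by (intro continuous_intros assms)

lemma continuous_on_transpose:
  fixes A :: "'a::topological_space \<Rightarrow> real^'m^'n"
  assumes "continuous_on S A"
  shows "continuous_on S (\<lambda>z. transpose (A z))"
  unfolding transpose_def by (intro continuous_intros assms)

lemma continuous_on_det:
  fixes A :: "'a::topological_space \<Rightarrow> real^'n^'n"
  assumes "continuous_on S A"
  shows "continuous_on S (\<lambda>z. det (A z))"
  unfolding det_def by (intro continuous_intros assms)

text \<open>The right inverse is \<open>transpose (B z)\<close> times the inverse of the Gram matrix
  \<open>B z ** transpose (B z)\<close>. That matrix is invertible because its quadratic form at
  \<open>w\<close> is the squared norm of \<open>transpose (B z) *v w\<close>; continuity of its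
  inverse is read off from determinants.\<close>

lemma continuous_right_inverse:
  fixes B :: "'a::topological_space \<Rightarrow> real^'m^'n"
  assumes cont: "continuous_on S B"
    and inj: "\<And>z w. z \<in> S \<Longrightarrow> transpose (B z) *v w = 0 \<Longrightarrow> w = 0"
  obtains G :: "'a \<Rightarrow> real^'n^'m"
  where "continuous_on S G" "\<And>z. z \<in> S \<Longrightarrow> B z ** G z = mat 1"
proof
  define M where "M z = B z ** transpose (B z)" for z
  \<comment> \<open>Column \<open>j\<close> of \<open>C z\<close> is Cramer's solution
    \<open>y\<close> of \<open>M z *v y = axis j 1\<close>.\<close>
  define C :: "'a \<Rightarrow> real^'n^'n" where
    "C z = (\<chi> i j. det (\<chi> k l. if l = i then axis j 1 $ k else M z $ k $ l) / det (M z))" for z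
  have det: "det (M z) \<noteq> 0" if z: "z \<in> S" for z
  proof -
    have "w = 0" if "M z *v w = 0" for w
    proof (rule inj[OF z])
      have "(transpose (B z) *v w) \<bullet> (transpose (B z) *v w) = w \<bullet> (M z *v w)"
        by (simp add: M_def dot_lmul_matrix matrix_vector_mul_assoc[symmetric])
      then show "transpose (B z) *v w = 0"
        using that by simp
    qed
    then show ?thesis
      by (metis invertible_det_nz invertible_left_inverse matrix_left_invertible_ker)
  qed
  have contM: "continuous_on S M"
    unfolding M_def by (intro continuous_on_matrix_mult continuous_on_transpose cont)
  have "continuous_on S (\<lambda>z. if l = i then axis j 1 $ k else M z $ k $ l)" for i j k l
    by (cases "l = i") (auto intro!: continuous_intros contM)
  then have "continuous_on S C"
    unfolding C_def by (intro continuous_intros continuous_on_det contM) (auto simp: det)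
  then show "continuous_on S (\<lambda>z. transpose (B z) ** C z)"
    by (intro continuous_on_matrix_mult continuous_on_transpose cont)
  show "B z ** (transpose (B z) ** C z) = mat 1" if "z \<in> S" for z
  proof -
    have "M z *v column j (C z) = axis j 1" for j
      unfolding cramer[OF det[OF that]] by (simp add: column_def C_def)
    then have "M z ** C z = mat 1"
      by (simp add: vec_eq_iff matrix_vector_mult_def matrix_matrix_mult_def column_def
          mat_def axis_def)
    then show ?thesis
      by (simp add: M_def matrix_mul_assoc)
  qed
qed

text \<open>Half the distance from \<open>(r, 0)\<close> to the set of failing pairs is a valid
  choice: distance is continuous, monotonicity of \<open>P\<close> keeps the failing pairs away from
  \<open>(r, 0)\<close>, and a failure at \<open>(r, \<omega> r)\<close> would bound the distance by
  half of itself.\<close>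

lemma continuous_positive_selection:
  fixes P :: "real \<Rightarrow> real \<Rightarrow> bool"
  assumes ex: "\<And>r. r > 0 \<Longrightarrow> \<exists>w>0. P r w"
    and mono: "\<And>r r' w w'. P r w \<Longrightarrow> r \<le> r' \<Longrightarrow> 0 < w' \<Longrightarrow> w' \<le> w \<Longrightarrow> P r' w'"
  obtains \<omega> where "continuous_on UNIV \<omega>" "\<And>r. r > 0 \<Longrightarrow> \<omega> r > 0" "\<And>r. r > 0 \<Longrightarrow> P r (\<omega> r)"
proof
  \<comment> \<open>The extra point keeps \<open>S\<close> nonempty, as \<open>infdist\<close> to
    the empty set is 0; it is farther than \<open>r\<close> from \<open>(r, 0)\<close>.\<close>
  define S where "S = insert (-1, 0) {(s, w). s > 0 \<and> w > 0 \<and> \<not> P s w}"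
  define \<omega> where "\<omega> r = infdist (r, 0) S / 2" for r :: real
  show "continuous_on UNIV \<omega>"
    unfolding \<omega>_def by (intro continuous_intros) auto
  show pos: "\<omega> r > 0" if "r > 0" for r
  proof -
    obtain w where w: "w > 0" "P (r/2) w"
      using ex[of "r/2"] \<open>r > 0\<close> by auto
    have "min (r/2) w \<le> dist (r, 0) p" if "p \<in> S" for p
    proof (cases p)
      case (Pair s v)
      have d: "\<bar>r - s\<bar> \<le> dist (r, 0) p" "\<bar>v\<bar> \<le> dist (r, 0) p"
        using dist_fst_le[of "(r, 0)" p] dist_snd_le[of "(r, 0)" p] Pair
        by (auto simp: dist_real_def)
      show ?thesis
      proof (rule ccontr)
        assume "\<not> ?thesis"
        then have "s \<ge> r/2" "v \<le> w"
          using d by auto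
        then show False
          using \<open>p \<in> S\<close> mono[OF w(2), of s v] Pair \<open>r > 0\<close> by (auto simp: S_def)
      qed
    qed
    moreover have "S \<noteq> {}"
      by (simp add: S_def)
    ultimately have "min (r/2) w \<le> infdist (r, 0) S"
      by (simp add: infdist_notempty cINF_greatest)
    then show ?thesis
      using w(1) \<open>r > 0\<close> by (auto simp: \<omega>_def min_def split: if_splits)
  qed
  show "P r (\<omega> r)" if "r > 0" for r
  proof (rule ccontr)
    assume "\<not> P r (\<omega> r)"
    then have "(r, \<omega> r) \<in> S"
      using pos[OF that] that by (auto simp: S_def)
    then have "infdist (r, 0) S \<le> dist (r, 0) (r, \<omega> r)"
      by (rule infdist_le)
    also have "\<dots> = \<omega> r"
      using pos[OF that] by (simp add: dist_Pair_Pair)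
    finally show False
      using pos[OF that] by (simp add: \<omega>_def)
  qed
qed

text \<open>The remainder of the implicit equation is controlled because the contraction hypothesis
  makes \<open>w\<close> Lipschitz at \<open>x0\<close> before its differentiability is known.\<close>

lemma differentiable_implicit_zero:
  fixes \<Phi> :: "'a::real_normed_vector \<times> 'b::euclidean_space \<Rightarrow> 'b" and w :: "'a \<Rightarrow> 'b"
  assumes der: "(\<Phi> has_derivative \<Phi>') (at (x0, w x0))"
    and zero: "\<forall>\<^sub>F x in nhds x0. \<Phi> (x, w x) = 0"
    and contr: "\<forall>\<^sub>F x in nhds x0.
      norm ((w x - \<Phi> (x, w x)) - (w x0 - \<Phi> (x, w x0))) \<le> norm (w x - w x0) / 2"
    and part: "\<And>v. norm (v - \<Phi>' (0, v)) \<le> norm v / 2"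
  shows "w differentiable (at x0)"
proof -
  interpret D: bounded_linear \<Phi>'
    using der by (rule has_derivative_bounded_linear)
  define S where "S v = \<Phi>' (0, v)" for v
  have S: "bounded_linear S"
    unfolding S_def
    by (intro bounded_linear_compose[OF D.bounded_linear_axioms] bounded_linear_Pair
        bounded_linear_zero bounded_linear_ident)
  interpret S: bounded_linear S by (rule S)
  have low: "norm v \<le> 2 * norm (S v)" for v
    using part[of v] norm_triangle_ineq2[of v "S v"] by (simp add: S_def)
  have "inj S"
    by (rule injI) (metis S.diff eq_iff_diff_eq_0 low mult_zero_right norm_le_zero_iff norm_zero)
  then obtain T where T: "linear T" "\<And>v. T (S v) = v"
    using linear_injective_left_inverse[OF S.linear_axioms] by (auto simp: fun_eq_iff)
  have T': "bounded_linear T"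
    using T(1) by (simp add: linear_linear)
  have "(w has_derivative (\<lambda>h. - T (\<Phi>' (h, 0)))) (at x0)"
    unfolding has_derivative_at_alt
  proof (intro conjI allI impI)
    show "bounded_linear (\<lambda>h. - T (\<Phi>' (h, 0)))"
      by (intro bounded_linear_minus bounded_linear_compose[OF T']
          bounded_linear_compose[OF D.bounded_linear_axioms] bounded_linear_Pair
          bounded_linear_zero bounded_linear_ident)
    fix e :: real assume "e > 0"
    obtain K where K: "K > 0" "\<And>v. norm (T v) \<le> norm v * K"
      using bounded_linear.pos_bounded[OF T'] by blast
    obtain K' where K': "K' > 0" "\<And>v. norm (\<Phi>' v) \<le> norm v * K'"
      using D.pos_bounded by blast
    \<comment> \<open>\<open>C\<close> turns out to be the Lipschitz constant of \<open>w\<close> at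
      \<open>x0\<close>; \<open>e1\<close> is chosen so that the final estimate
      \<open>e1 * (1 + C) * K\<close> equals \<open>e\<close>.\<close>
    define C where "C = 2 * (K' + 1)"
    have "C > 0"
      using K'(1) by (simp add: C_def)
    define e1 where "e1 = e / (K * (1 + C))"
    have "e1 > 0"
      using \<open>e > 0\<close> \<open>C > 0\<close> K(1) by (simp add: e1_def)
    have zero0: "\<Phi> (x0, w x0) = 0"
      using zero by (rule eventually_nhds_x_imp_x)
    obtain d1 where d1: "d1 > 0" "\<And>p. norm (p - (x0, w x0)) < d1 \<Longrightarrow>
        norm (\<Phi> p - \<Phi>' (p - (x0, w x0))) \<le> e1 * norm (p - (x0, w x0))"
      using der \<open>e1 > 0\<close> zero0 unfolding has_derivative_at_alt by (metis diff_zero)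
    \<comment> \<open>Differentiability with tolerance 1 bounds \<open>\<Phi> (x, w x0)\<close> by
      \<open>(K' + 1) * norm (x - x0)\<close>.\<close>
    obtain d2 where d2: "d2 > 0" "\<And>p. norm (p - (x0, w x0)) < d2 \<Longrightarrow>
        norm (\<Phi> p - \<Phi>' (p - (x0, w x0))) \<le> 1 * norm (p - (x0, w x0))"
      using der zero0 zero_less_one unfolding has_derivative_at_alt by (metis diff_zero)
    obtain d3 where d3: "d3 > 0" "\<And>x. dist x x0 < d3 \<Longrightarrow> \<Phi> (x, w x) = 0"
        "\<And>x. dist x x0 < d3 \<Longrightarrow>
          norm ((w x - \<Phi> (x, w x)) - (w x0 - \<Phi> (x, w x0))) \<le> norm (w x - w x0) / 2"
      using eventually_conj[OF zero contr] unfolding eventually_nhds_metric by blast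
    define d where "d = Min {d1 / (1 + C), d2, d3}"
    have "d > 0"
      using d1(1) d2(1) d3(1) \<open>C > 0\<close> by (simp add: d_def)
    have "norm (w x - w x0 - - T (\<Phi>' (x - x0, 0))) \<le> e * norm (x - x0)"
      if x: "norm (x - x0) < d" for x
    proof -
      let ?h = "x - x0" and ?k = "w x - w x0"
      have x': "norm ?h < d1 / (1 + C)" "norm ?h < d2" "dist x x0 < d3"
        using x by (simp_all add: d_def dist_norm)
      have "norm (\<Phi> (x, w x0) - \<Phi>' (?h, 0)) \<le> norm ?h"
        using d2(2)[of "(x, w x0)"] x' by simp
      moreover have "norm (\<Phi>' (?h, 0)) \<le> norm ?h * K'"
        using K'(2)[of "(?h, 0)"] by simp
      ultimately have 1: "norm (\<Phi> (x, w x0)) \<le> (K' + 1) * norm ?h"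
        using norm_triangle_sub[of "\<Phi> (x, w x0)" "\<Phi>' (?h, 0)"] by (simp add: algebra_simps)
      \<comment> \<open>Since \<open>\<Phi> (x, w x) = 0\<close>, the contraction hypothesis
        compares the increment of \<open>w\<close> with \<open>\<Phi> (x, w x0)\<close>
        alone.\<close>
      have "norm (?k + \<Phi> (x, w x0)) \<le> norm ?k / 2"
        using d3(3)[OF x'(3)] d3(2)[OF x'(3)] by (simp add: algebra_simps)
      then have "norm ?k \<le> 2 * norm (\<Phi> (x, w x0))"
        using norm_triangle_ineq2[of ?k "- \<Phi> (x, w x0)"] by simp
      then have k: "norm ?k \<le> C * norm ?h"
        using 1 by (simp add: C_def algebra_simps)
      have "norm (?h, ?k) \<le> norm ?h + norm ?k"
        by (rule norm_Pair_le)
      then have hk: "norm (?h, ?k) \<le> (1 + C) * norm ?h"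
        using k by (simp add: algebra_simps)
      also have "\<dots> < d1"
        using x'(1) \<open>C > 0\<close> by (simp add: field_simps)
      finally have "norm (\<Phi>' (?h, ?k)) \<le> e1 * norm (?h, ?k)"
        using d1(2)[of "(x, w x)"] d3(2)[OF x'(3)] by simp
      also have "\<dots> \<le> e1 * ((1 + C) * norm ?h)"
        using hk \<open>e1 > 0\<close> by simp
      finally have 2: "norm (\<Phi>' (?h, ?k)) \<le> e1 * ((1 + C) * norm ?h)" .
      have "?k - - T (\<Phi>' (?h, 0)) = T (S ?k) + T (\<Phi>' (?h, 0))"
        by (simp add: T(2))
      also have "\<dots> = T (\<Phi>' (?h, ?k))"
        using D.add[of "(0, ?k)" "(?h, 0)"] by (simp add: S_def linear_add[OF T(1)])
      finally have "norm (?k - - T (\<Phi>' (?h, 0))) \<le> norm (\<Phi>' (?h, ?k)) * K"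
        using K(2) by metis
      also have "\<dots> \<le> e1 * ((1 + C) * norm ?h) * K"
        using 2 K(1) by simp
      also have "\<dots> = e * norm ?h"
        using K(1) \<open>C > 0\<close> by (simp add: e1_def)
      finally show ?thesis .
    qed
    then show "\<exists>d>0. \<forall>x. norm (x - x0) < d \<longrightarrow>
        norm (w x - w x0 - - T (\<Phi>' (x - x0, 0))) \<le> e * norm (x - x0)"
      using \<open>d > 0\<close> by blast
  qed
  then show ?thesis
    by (auto simp: differentiable_def)
qed

section \<open>Smooth approximation on a punctured ball\<close>

text \<open>The square of a positive part is differentiable even at 0, and the two squares in the
  denominator never vanish together, so this quotient is a differentiable step from 0 to 1.\<close>

definition smoothstep :: "real \<Rightarrow> real" where
  "smoothstep s = (max 0 s)\<^sup>2 / ((max 0 s)\<^sup>2 + (max 0 (1 - s))\<^sup>2)"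

lemma smoothstep_simps: "s \<le> 0 \<Longrightarrow> smoothstep s = 0" "1 \<le> s \<Longrightarrow> smoothstep s = 1"
  by (auto simp: smoothstep_def)

lemma smoothstep_bounds: "0 \<le> smoothstep s" "smoothstep s \<le> 1"
proof -
  have "a / (a + b) \<le> 1" if "a \<ge> 0" "b \<ge> 0" for a b :: real
    using that by (cases "a + b = 0") (auto simp: divide_le_eq_1)
  then show "smoothstep s \<le> 1"
    by (simp add: smoothstep_def)
qed (simp add: smoothstep_def)

lemma differentiable_transform_eventually:
  assumes "f differentiable (at x)" "\<forall>\<^sub>F y in nhds x. f y = g y"
  shows "g differentiable (at x)"
proof -
  have "\<forall>\<^sub>F y in at x. f y = g y" "f x = g x"
    using assms(2) by (auto simp: eventually_nhds_conv_at)
  then show ?thesis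
    using assms(1) has_derivative_transform_eventually[of f _ x UNIV g]
    unfolding differentiable_def by blast
qed

lemma differentiable_max_0_sq: "(\<lambda>s::real. (max 0 s)\<^sup>2) differentiable (at s)"
proof (cases s "0::real" rule: linorder_cases)
  case less
  then have ev: "\<forall>\<^sub>F t in nhds s. t \<in> {..<0}"
    by (intro eventually_nhds_in_open) auto
  show ?thesis
  proof (rule differentiable_transform_eventually[of "\<lambda>_. 0"])
    show "\<forall>\<^sub>F t in nhds s. (0) = (max 0 t)\<^sup>2"
      using ev by eventually_elim simp
  qed simp
next
  case equal
  have "((\<lambda>s::real. (max 0 s)\<^sup>2) has_derivative (\<lambda>_. 0)) (at 0)"
    unfolding has_derivative_at_alt
  proof (intro conjI allI impI)
    fix e :: real assume "e > 0"
    have "(max 0 t)\<^sup>2 \<le> e * \<bar>t\<bar>" if "\<bar>t\<bar> < e" for t :: real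
      using that \<open>e > 0\<close>
      by (auto simp: max_def power2_eq_square mult_nonneg_nonpos intro: mult_right_mono)
    then show "\<exists>d>0. \<forall>t :: real. norm (t - 0) < d \<longrightarrow>
        norm ((max 0 t)\<^sup>2 - (max 0 0)\<^sup>2 - 0) \<le> e * norm (t - 0)"
      using \<open>e > 0\<close> by (intro exI[of _ e]) simp
  qed auto
  then show ?thesis
    using equal by (auto simp: differentiable_def)
next
  case greater
  then have ev: "\<forall>\<^sub>F t in nhds s. t \<in> {0<..}"
    by (intro eventually_nhds_in_open) auto
  show ?thesis
  proof (rule differentiable_transform_eventually[of "\<lambda>t. t\<^sup>2"])
    show "\<forall>\<^sub>F t in nhds s. (t\<^sup>2) = (max 0 t)\<^sup>2"
      using ev by eventually_elim simp
  qed simp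
qed

lemma differentiable_smoothstep: "smoothstep differentiable (at s)"
proof -
  have "(\<lambda>s::real. (max 0 (1 - s))\<^sup>2) differentiable (at s)"
    using differentiable_chain_at[of "\<lambda>s. 1 - s" s, OF _ differentiable_max_0_sq]
    by (simp add: o_def)
  moreover have "(max 0 s)\<^sup>2 + (max 0 (1 - s))\<^sup>2 \<noteq> 0"
    by (auto simp: add_nonneg_eq_0_iff max_def split: if_splits)
  ultimately show ?thesis
    unfolding smoothstep_def
    by (intro differentiable_divide differentiable_add differentiable_max_0_sq)
qed

text \<open>Stone-Weierstrass gives a polynomial on each compact shell, accurate to the minimum of
  \<open>\<eta>\<close> there. Consecutive polynomials are glued by convex weights, which preserves
  the pointwise error bound.\<close>

lemma smooth_approximation_punctured:
  fixes h :: "'a::euclidean_space \<Rightarrow> 'b::euclidean_space" and \<eta> :: "'a \<Rightarrow> real" and s :: real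
  assumes h: "continuous_on (cball 0 s - {0}) h" and \<eta>: "continuous_on (cball 0 s - {0}) \<eta>"
    and pos: "\<And>x. x \<in> cball 0 s - {0} \<Longrightarrow> \<eta> x > 0"
  shows "\<exists>g. (\<forall>x. x \<noteq> 0 \<longrightarrow> g differentiable (at x)) \<and>
    (\<forall>x \<in> cball 0 s - {0}. norm (g x - h x) \<le> \<eta> x)"
proof -
  \<comment> \<open>All shells reach out to radius \<open>s\<close>, so they increase with
    \<open>k\<close> and \<open>p (Suc k)\<close> is accurate wherever \<open>p k\<close>
    is.\<close>
  define A where "A k = {x::'a. (1/2)^(k+1) \<le> norm x \<and> norm x \<le> s}" for k :: nat
  have "\<exists>p. polynomial_function p \<and> (\<forall>x\<in>A k. norm (h x - p x) < \<eta> x)" for k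
  proof -
    have A: "A k = cball 0 s - ball 0 ((1/2)^(k+1))"
      by (auto simp: A_def)
    have compact: "compact (A k)"
      unfolding A by (intro compact_diff) auto
    have "(0::real) < (1/2)^(k+1)"
      by (intro zero_less_power) simp
    then have "0 \<notin> A k"
      unfolding A_def mem_Collect_eq norm_zero by linarith
    then have sub: "A k \<subseteq> cball 0 s - {0}"
      by (auto simp: A_def)
    have "\<exists>e>0. \<forall>x\<in>A k. e \<le> \<eta> x"
    proof (cases "A k = {}")
      case False
      then obtain x where "x \<in> A k" "\<And>y. y \<in> A k \<Longrightarrow> \<eta> x \<le> \<eta> y"
        using continuous_attains_inf[OF compact _ continuous_on_subset[OF \<eta> sub]] by blast
      then show ?thesis
        using pos sub by blast
    qed (auto intro: exI[of _ 1])
    then obtain e where e: "e > 0" "\<And>x. x \<in> A k \<Longrightarrow> e \<le> \<eta> x"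
      by blast
    from Stone_Weierstrass_polynomial_function[OF compact continuous_on_subset[OF h sub] e(1)]
    show ?thesis
      using e(2) by (meson order_less_le_trans)
  qed
  then obtain p where p: "\<And>k. polynomial_function (p k)"
      "\<And>k x. x \<in> A k \<Longrightarrow> norm (h x - p k x) < \<eta> x"
    by metis
  text \<open>The weight \<open>\<beta> k\<close> switches from \<open>p k\<close> to \<open>p (Suc k)\<close> while the norm decreases from
    \<open>(1/2)^k\<close> to \<open>(1/2)^(k+1)\<close>.\<close>
  define \<beta> where "\<beta> k x = smoothstep ((4 - 4 * 4^k * (norm x)\<^sup>2) / 3)" for k and x :: 'a
  have four: "((2::real)^k)\<^sup>2 = 4^k" for k
    by (simp add: power2_eq_square flip: power_mult_distrib)
  have \<beta>0: "\<beta> k x = 0" if "(1/2)^k \<le> norm x" for k x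
  proof -
    have "2^k * (1/2)^k \<le> 2^k * norm x"
      using that by (intro mult_left_mono) auto
    then have "1 \<le> 2^k * norm x"
      by (simp flip: power_mult_distrib)
    then have "1\<^sup>2 \<le> (2^k * norm x)\<^sup>2"
      by (intro power_mono) auto
    then have "1 \<le> 4^k * (norm x)\<^sup>2"
      by (simp add: power_mult_distrib four)
    then show ?thesis
      unfolding \<beta>_def by (intro smoothstep_simps) simp
  qed
  have \<beta>1: "\<beta> k x = 1" if "norm x \<le> (1/2)^(k+1)" for k x
  proof -
    have "2 * 2^k * norm x \<le> 1"
      using that by (simp add: power_divide field_simps)
    then have "(2 * 2^k * norm x)\<^sup>2 \<le> 1\<^sup>2"
      by (intro power_mono) auto
    then have "4 * 4^k * (norm x)\<^sup>2 \<le> 1"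
      by (simp add: power_mult_distrib four)
    then show ?thesis
      unfolding \<beta>_def by (intro smoothstep_simps) simp
  qed
  \<comment> \<open>With weights 1 the sum telescopes to \<open>p K\<close>. The weight
    \<open>\<beta> k\<close> vanishes where \<open>(1/2)^k \<le> norm x\<close>, so outside a ball
    of radius \<open>(1/2)^K\<close> all longer sums agree with \<open>q K\<close>; hence
    \<open>g\<close> is locally a finite sum.\<close>
  define q where "q K x = p 0 x + (\<Sum>k<K. \<beta> k x *\<^sub>R (p (Suc k) x - p k x))" for K x
  define N where "N x = (LEAST k. (1/2)^k \<le> norm x)" for x :: 'a
  define g where "g x = q (N x) x" for x
  have q_eq: "q K x = g x" if K: "(1/2)^K \<le> norm x" for K x
  proof -
    have N: "(1/2)^N x \<le> norm x" "N x \<le> K"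
      unfolding N_def using K by (auto intro: LeastI Least_le)
    have "\<beta> k x = 0" if "N x \<le> k" for k
    proof (rule \<beta>0)
      have "(1/2::real)^k \<le> (1/2)^N x"
        using that by (intro power_decreasing) auto
      then show "(1/2)^k \<le> norm x"
        using N(1) by (rule order_trans)
    qed
    then have "(\<Sum>k<K. \<beta> k x *\<^sub>R (p (Suc k) x - p k x)) =
        (\<Sum>k<N x. \<beta> k x *\<^sub>R (p (Suc k) x - p k x))"
      using N(2) by (intro sum.mono_neutral_right) auto
    then show ?thesis
      by (simp add: g_def q_def)
  qed
  have ex: "\<exists>K. (1/2)^K < norm x" if "x \<noteq> 0" for x :: 'a
    using real_arch_pow_inv[of "norm x" "1/2"] that by simp
  show ?thesis
  proof (intro exI conjI allI impI ballI)
    fix x :: 'a assume "x \<noteq> 0"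
    obtain K where K: "(1/2)^K < norm x"
      using ex[OF \<open>x \<noteq> 0\<close>] by blast
    have "(\<lambda>x. (4 - 4 * 4^k * (norm x)\<^sup>2) / 3) differentiable (at x)" for k
      using \<open>x \<noteq> 0\<close> by (auto intro!: derivative_intros differentiable_norm_at)
    from differentiable_chain_at[OF this differentiable_smoothstep]
    have "\<beta> k differentiable (at x)" for k
      by (simp add: o_def \<beta>_def[abs_def])
    then have "q K differentiable (at x)"
      unfolding q_def
      by (intro differentiable_add differentiable_sum ballI differentiable_scaleR
          differentiable_diff finite_lessThan)
        (simp_all add: differentiable_at_polynomial_function p)
    moreover have "\<forall>\<^sub>F y in nhds x. q K y = g y"
    proof -
      have "open {y::'a. (1/2)^K < norm y}"
        by (intro open_Collect_less continuous_intros)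
      then have "\<forall>\<^sub>F y in nhds x. (1/2)^K < norm y"
        using K eventually_nhds_in_open by fastforce
      then show ?thesis
        by eventually_elim (simp add: q_eq)
    qed
    ultimately show "g differentiable (at x)"
      using differentiable_transform_eventually by blast
  next
    fix x :: 'a assume x: "x \<in> cball 0 s - {0}"
    have N: "(1/2)^N x \<le> norm x"
      unfolding N_def by (rule LeastI_ex) (use ex[of x] x less_imp_le in blast)
    show "norm (g x - h x) \<le> \<eta> x"
    proof (cases "N x")
      case 0
      then have "x \<in> A 0"
        using N x by (auto simp: A_def)
      then show ?thesis
        using p(2)[of x 0] 0 by (simp add: g_def q_def norm_minus_commute)
    next
      \<comment> \<open>Here the norm lies between \<open>(1/2)^(k+1)\<close> and
        \<open>(1/2)^k\<close>: the weights before \<open>k\<close> equal 1, and only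
        \<open>\<beta> k\<close> is in transition.\<close>
      case (Suc k)
      have up: "norm x < (1/2)^k"
        using not_less_Least[of k "\<lambda>k. (1/2)^k \<le> norm x"] Suc by (simp add: N_def)
      have A: "x \<in> A k" "x \<in> A (Suc k)"
        using N up Suc x by (auto simp: A_def)
      have "\<beta> j x = 1" if "j < k" for j
      proof (rule \<beta>1)
        have "(1/2::real)^k \<le> (1/2)^(j+1)"
          using that by (intro power_decreasing) auto
        then show "norm x \<le> (1/2)^(j+1)"
          using up by linarith
      qed
      then have "q k x = p k x"
        using sum_lessThan_telescope[of "\<lambda>j. p j x" k] by (simp add: q_def)
      then have g: "g x = p k x + \<beta> k x *\<^sub>R (p (Suc k) x - p k x)"
        by (simp add: g_def Suc q_def)
      have "g x - h x = (1 - \<beta> k x) *\<^sub>R (p k x - h x) + \<beta> k x *\<^sub>R (p (Suc k) x - h x)"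
        by (simp add: g algebra_simps)
      also have "norm \<dots> \<le> (1 - \<beta> k x) * norm (p k x - h x) + \<beta> k x * norm (p (Suc k) x - h x)"
        using smoothstep_bounds by (intro norm_triangle_le) (simp add: \<beta>_def)
      also have "\<dots> \<le> (1 - \<beta> k x) * \<eta> x + \<beta> k x * \<eta> x"
        using p(2)[OF A(1)] p(2)[OF A(2)] smoothstep_bounds
        by (intro add_mono mult_left_mono) (auto simp: \<beta>_def norm_minus_commute)
      finally show ?thesis
        by (simp add: algebra_simps)
    qed
  qed
qed

section \<open>Quantitative Newton steps\<close>

text \<open>\<open>B\<close> is the control part of the derivative. Its right inverse
  \<open>G\<close> is available only off the origin and may blow up there, so the radii below must
  depend on the distance to the origin.\<close>

locale punctured_submersion =
  fixes f :: "(real^'n) \<times> (real^'m) \<Rightarrow> real^'n"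
    and f' :: "(real^'n) \<times> (real^'m) \<Rightarrow> (real^'n) \<times> (real^'m) \<Rightarrow> real^'n"
    and B :: "(real^'n) \<times> (real^'m) \<Rightarrow> real^'m^'n"
    and G :: "(real^'n) \<times> (real^'m) \<Rightarrow> real^'n^'m"
    and R L :: real
  assumes R: "R > 0" and L: "L > 0"
    and f0: "f 0 = 0"
    and der: "z \<in> cball 0 R \<Longrightarrow> (f has_derivative f' z) (at z)"
    and f'_bound: "z \<in> cball 0 R \<Longrightarrow> onorm (f' z) \<le> L"
    and B: "z \<in> cball 0 R \<Longrightarrow> f' z (0, v) = B z *v v"
    and contB: "continuous_on (cball 0 R) B"
    and contG: "continuous_on (cball 0 R - {0}) G"
    and BG: "z \<in> cball 0 R - {0} \<Longrightarrow> B z ** G z = mat 1"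
begin

section \<open>Lipschitz bounds and a uniform contraction radius\<close>

lemma f_lipschitz:
  assumes "z \<in> cball 0 R" "z' \<in> cball 0 R"
  shows "norm (f z - f z') \<le> L * norm (z - z')"
  by (rule differentiable_bound[OF convex_cball _ f'_bound assms])
    (use der has_derivative_at_withinI in blast)

lemma f_bound: "z \<in> cball 0 R \<Longrightarrow> norm (f z) \<le> L * norm z"
  using f_lipschitz[of z 0] R f0 by simp

lemma cont_f: "continuous_on (cball 0 R) f"
  using der has_derivative_continuous continuous_at_imp_continuous_on by blast

text \<open>The derivative of \<open>f\<close> in the coordinates \<open>a\<close> is within 1/2 of
  the identity. The slack in \<open>v\<close> and \<open>G'\<close> leaves room for replacing the
  control and the right inverse by differentiable approximations.\<close>

definition newton_radius :: "(real^'n) \<times> (real^'m) \<Rightarrow> real \<Rightarrow> bool" where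
  "newton_radius z w \<longleftrightarrow> (\<forall>v G'. norm v \<le> w \<and> norm (G' - G z) \<le> w \<longrightarrow>
     (\<forall>a \<in> cball 0 w. (fst z, snd z + v + G' *v a) \<in> cball 0 R \<and>
        (\<forall>d. norm (d - f' (fst z, snd z + v + G' *v a) (0, G' *v d)) \<le> norm d / 2)))"

lemma newton_radiusD:
  assumes "newton_radius z w" "norm v \<le> w" "norm (G' - G z) \<le> w" "norm a \<le> w"
  shows "(fst z, snd z + v + G' *v a) \<in> cball 0 R"
    "norm (d - f' (fst z, snd z + v + G' *v a) (0, G' *v d)) \<le> norm d / 2"
proof -
  have "a \<in> cball 0 w"
    using assms(4) by simp
  then show "(fst z, snd z + v + G' *v a) \<in> cball 0 R"
    "norm (d - f' (fst z, snd z + v + G' *v a) (0, G' *v d)) \<le> norm d / 2"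
    using assms(1-3) unfolding newton_radius_def by blast+
qed

text \<open>Mean value inequality on the convex ball of admissible \<open>a\<close>: the derivative
  bound in \<open>newton_radius\<close> is a Lipschitz constant 1/2.\<close>

lemma newton_contraction:
  assumes "newton_radius z w" "norm v \<le> w" "norm (G' - G z) \<le> w" "norm a \<le> w" "norm b \<le> w"
  shows "norm ((a - f (fst z, snd z + v + G' *v a)) - (b - f (fst z, snd z + v + G' *v b)))
    \<le> norm (a - b) / 2"
proof -
  let ?p = "\<lambda>a :: real^'n. (fst z, snd z + v + G' *v a)"
  have p: "?p a \<in> cball 0 R" "norm (d - f' (?p a) (0, G' *v d)) \<le> norm d / 2"
    if "a \<in> cball 0 w" for a d
    using newton_radiusD[OF assms(1-3)] that by auto
  have "norm ((a - f (?p a)) - (b - f (?p b))) \<le> 1/2 * norm (a - b)"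
  proof (rule differentiable_bound[where S = "cball 0 w"])
    fix c :: "real^'n" assume c: "c \<in> cball 0 w"
    have "(?p has_derivative (\<lambda>d. (0, G' *v d))) (at c)"
      by (auto intro!: derivative_eq_intros bounded_linear_imp_has_derivative
          bounded_bilinear.bounded_linear_right[OF bounded_bilinear_matrix_vector_mult])
    from has_derivative_compose[OF this der[OF p(1)[OF c]]]
    have "((\<lambda>a. a - f (?p a)) has_derivative (\<lambda>d. d - f' (?p c) (0, G' *v d))) (at c)"
      by (intro derivative_intros) (simp add: o_def)
    then show "((\<lambda>a. a - f (?p a)) has_derivative (\<lambda>d. d - f' (?p c) (0, G' *v d)))
        (at c within cball 0 w)"
      by (rule has_derivative_at_withinI)
    show "onorm (\<lambda>d. d - f' (?p c) (0, G' *v d)) \<le> 1/2"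
      by (rule onorm_le) (use p(2)[OF c] in auto)
  qed (use assms in auto)
  then show ?thesis by simp
qed

text \<open>Asking for one \<open>w\<close> at all points outside the ball of radius
  \<open>r\<close> makes the condition monotone, as the continuous selection requires. The last
  inequality keeps corrections short compared with the distance to the origin.\<close>

definition admissible :: "real \<Rightarrow> real \<Rightarrow> bool" where
  "admissible r w \<longleftrightarrow> w \<le> L * r \<and> (\<forall>z. r \<le> norm z \<and> norm z \<le> R/2 \<longrightarrow>
     newton_radius z w \<and> (norm (G z) + 2) * w \<le> r / 4)"

lemma admissible_mono:
  assumes "admissible r w" "r \<le> r'" "0 < w'" "w' \<le> w"
  shows "admissible r' w'"
proof -
  have "newton_radius z w'" "(norm (G z) + 2) * w' \<le> r' / 4"
    if z: "r' \<le> norm z" "norm z \<le> R/2" for z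
  proof -
    have a: "newton_radius z w" "(norm (G z) + 2) * w \<le> r / 4"
      using assms(1,2) z order_trans[of r r' "norm z"] unfolding admissible_def by blast+
    then show "newton_radius z w'"
      using assms(3,4) unfolding newton_radius_def by (meson order_trans mem_cball_0)
    have "(norm (G z) + 2) * w' \<le> (norm (G z) + 2) * w"
      using assms(4) by (intro mult_left_mono) auto
    then show "(norm (G z) + 2) * w' \<le> r' / 4"
      using a(2) assms(2) by simp
  qed
  moreover have "w' \<le> L * r'"
    using assms L unfolding admissible_def by (smt (verit) mult_left_mono)
  ultimately show ?thesis
    unfolding admissible_def by blast
qed

lemma G_bounded:
  assumes "r > 0"
  obtains C where "C > 0" "\<And>z. r \<le> norm z \<Longrightarrow> norm z \<le> R \<Longrightarrow> norm (G z) \<le> C"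
proof -
  have "compact (cball 0 R - ball (0 :: (real^'n) \<times> (real^'m)) r)"
    by (intro compact_diff compact_cball open_ball)
  moreover have "continuous_on (cball 0 R - ball 0 r) G"
    using assms by (intro continuous_on_subset[OF contG]) auto
  ultimately have "bounded (G ` (cball 0 R - ball 0 r))"
    by (intro compact_imp_bounded compact_continuous_image)
  then show thesis
    using that unfolding bounded_pos by fastforce
qed

text \<open>The product \<open>B z ** M\<close> is uniformly continuous on a compact set of pairs
  and equals the identity at \<open>(z, G z)\<close>, so nearby pairs give products within 1/2 of
  the identity, uniformly in \<open>z\<close>.\<close>

lemma admissible_exists:
  assumes "r > 0"
  shows "\<exists>w>0. admissible r w"
proof -
  obtain C where C: "C > 0" "\<And>z. r \<le> norm z \<Longrightarrow> norm z \<le> R \<Longrightarrow> norm (G z) \<le> C"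
    using G_bounded[OF assms] by blast
  let ?K = "cball (0 :: (real^'n) \<times> (real^'m)) R \<times> cball (0::real^'n^'m) (C + 1)"
  have "compact ?K"
    by (intro compact_Times) auto
  moreover have "continuous_on ?K (\<lambda>(z, M). B z ** M)"
    unfolding case_prod_beta
    by (intro continuous_on_matrix_mult continuous_on_compose2[OF contB] continuous_intros) auto
  ultimately have "uniformly_continuous_on ?K (\<lambda>(z, M). B z ** M)"
    by (rule compact_uniformly_continuous[rotated])
  then obtain e where e: "e > 0" "\<And>p q. p \<in> ?K \<Longrightarrow> q \<in> ?K \<Longrightarrow> dist q p < e \<Longrightarrow>
      dist (B (fst q) ** snd q) (B (fst p) ** snd p) < 1/2"
    unfolding uniformly_continuous_on_def case_prod_beta by (metis half_gt_zero zero_less_one)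
  \<comment> \<open>A perturbed point is at distance at most \<open>(C + 2) * w\<close> from
    \<open>z\<close>, and the pair \<open>(q, G')\<close> at most \<open>(C + 3) * w\<close> from
    \<open>(z, G z)\<close>; the bound 1 gives \<open>norm G' \<le> C + 1\<close>.\<close>
  define w where "w = Min {1, L * r, r / (4 * (C + 2)), e / (2 * (C + 3)), R / (2 * (C + 2))}"
  have w: "w > 0" "w \<le> 1" "w \<le> L * r" "w \<le> r / (4 * (C + 2))" "w \<le> e / (2 * (C + 3))"
    "w \<le> R / (2 * (C + 2))"
    using assms L R C(1) e(1) by (simp_all add: w_def)
  have "newton_radius z w" "(norm (G z) + 2) * w \<le> r / 4"
    if z: "r \<le> norm z" "norm z \<le> R/2" for z
  proof -
    have Gz: "norm (G z) \<le> C"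
      using C(2) z R by simp
    have "(norm (G z) + 2) * w \<le> (C + 2) * (r / (4 * (C + 2)))"
      using Gz w(1,4) C(1) by (intro mult_mono) auto
    also have "\<dots> = r / 4"
      using C(1) by (simp add: field_simps)
    finally show "(norm (G z) + 2) * w \<le> r / 4" .
    show "newton_radius z w"
      unfolding newton_radius_def
    proof (intro allI impI ballI)
      fix v :: "real^'m" and G' :: "real^'n^'m" and a :: "real^'n"
      assume "norm v \<le> w \<and> norm (G' - G z) \<le> w" and a: "a \<in> cball 0 w"
      then have v: "norm v \<le> w" and G': "norm (G' - G z) \<le> w"
        by auto
      have nG': "norm G' \<le> C + 1"
        using norm_triangle_sub[of G' "G z"] G' Gz w(2) by simp
      define q where "q = (fst z, snd z + v + G' *v a)"
      have "norm (q - z) = norm (v + G' *v a)"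
        by (simp add: q_def norm_prod_def)
      also have "\<dots> \<le> w + (C + 1) * w"
        using norm_matrix_vector_mult_le[of G' a] v mult_mono[OF nG', of "norm a" w] a w(1) C(1)
        by (intro norm_triangle_le) (auto simp: algebra_simps)
      finally have qz: "norm (q - z) \<le> (C + 2) * w"
        by (simp add: algebra_simps)
      have "(C + 2) * w \<le> R / 2"
        using w(6) C(1) by (simp add: field_simps)
      then have q: "q \<in> cball 0 R"
        using norm_triangle_sub[of q z] qz z(2) by simp
      have "dist (q, G') (z, G z) \<le> norm (q - z) + norm (G' - G z)"
        using norm_Pair_le[of "q - z" "G' - G z"] by (simp add: dist_norm)
      also have "\<dots> \<le> (C + 3) * w"
        using qz G' by (simp add: algebra_simps)
      also have "\<dots> \<le> e / 2"
        using w(5) C(1) by (simp add: field_simps)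
      also have "\<dots> < e"
        using e(1) by simp
      finally have "dist (B q ** G') (B z ** G z) < 1/2"
        using e(2)[of "(z, G z)" "(q, G')"] q nG' Gz z R by simp
      moreover have "B z ** G z = mat 1"
        using z assms R by (intro BG) auto
      ultimately have M: "norm (mat 1 - B q ** G') \<le> 1/2"
        by (simp add: dist_norm norm_minus_commute)
      have "norm (d - f' q (0, G' *v d)) \<le> norm d / 2" for d
      proof -
        have "d - f' q (0, G' *v d) = (mat 1 - B q ** G') *v d"
          by (simp add: B[OF q] matrix_vector_mult_diff_rdistrib matrix_vector_mul_assoc)
        also have "norm \<dots> \<le> norm (mat 1 - B q ** G') * norm d"
          by (rule norm_matrix_vector_mult_le)
        also have "\<dots> \<le> 1/2 * norm d"
          using M by (intro mult_right_mono) auto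
        finally show ?thesis by simp
      qed
      with q show "(fst z, snd z + v + G' *v a) \<in> cball 0 R \<and> (\<forall>d. norm (d -
          f' (fst z, snd z + v + G' *v a) (0, G' *v d)) \<le> norm d / 2)"
        by (simp add: q_def)
    qed
  qed
  then show ?thesis
    using w(1,3) unfolding admissible_def by blast
qed

end

section \<open>Newton continuation along the segment\<close>

text \<open>The argument \<open>r / 4\<close> in the admissibility assumption matches the lower
  bound \<open>norm x / 4\<close> for the points met by the iteration at \<open>x\<close>.\<close>

locale newton_continuation = punctured_submersion f f' B G R L
  for f :: "(real^'n) \<times> (real^'m) \<Rightarrow> real^'n" and f' B G R L +
  fixes e :: "real^'n" and w :: "real \<Rightarrow> real"
  assumes e: "norm e = 1"
    and w_cont: "continuous_on {0<..} w"
    and w_pos: "r > 0 \<Longrightarrow> w r > 0"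
    and w_admissible: "r > 0 \<Longrightarrow> admissible (r / 4) (w r)"
begin

text \<open>In one step of length \<open>\<tau> x\<close> the target moves by at most
  \<open>4 * L * norm x * \<tau> x\<close>, and moving \<open>\<xi>\<close> changes \<open>f\<close>
  by at most \<open>2 * L * norm x * \<tau> x\<close>. Together this is
  \<open>w (norm x) / 8\<close>, half of the residual tolerance
  \<open>w (norm x) / 4\<close>.\<close>

definition \<tau> :: "real^'n \<Rightarrow> real" where
  "\<tau> x = w (norm x) / (48 * L * norm x)"

definition T :: "nat \<Rightarrow> real^'n \<Rightarrow> real" where
  "T k x = min 1 (real k * \<tau> x)"

text \<open>The damping factor vanishes once \<open>T k x = 1\<close>, so near each \<open>x \<noteq> 0\<close> the iteration is
  eventually constant and its continuity in \<open>x\<close> passes to the final value.\<close>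

definition damp :: "nat \<Rightarrow> real^'n \<Rightarrow> real" where
  "damp k x = (T (Suc k) x - T k x) / \<tau> x"

definition \<xi> :: "real^'n \<Rightarrow> real \<Rightarrow> real^'n" where
  "\<xi> x t = ((1 - t) * norm x) *\<^sub>R e + t *\<^sub>R x"

definition target :: "real^'n \<Rightarrow> real \<Rightarrow> real^'n" where
  "target x t = (1 - t) *\<^sub>R f (norm x *\<^sub>R e, 0) - (3 * L * t) *\<^sub>R x"

text \<open>The index is shifted on purpose: step \<open>k\<close> starts from the control reached
  at time \<open>T k x\<close> and corrects it against the data at time
  \<open>T (Suc k) x\<close>.\<close>

definition node :: "nat \<Rightarrow> real^'n \<Rightarrow> real^'m \<Rightarrow> (real^'n) \<times> (real^'m)" where
  "node k x v = (\<xi> x (T (Suc k) x), v)"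

definition resid :: "nat \<Rightarrow> real^'n \<Rightarrow> real^'m \<Rightarrow> real^'n" where
  "resid k x v = target x (T (Suc k) x) - f (node k x v)"

primrec newton :: "nat \<Rightarrow> real^'n \<Rightarrow> real^'m" where
  "newton 0 x = 0"
| "newton (Suc k) x = newton k x +
     damp k x *\<^sub>R (G (node k x (newton k x)) *v resid k x (newton k x))"

section \<open>Bounds on step size, damping, segment and target\<close>

lemma \<tau>_pos: "x \<noteq> 0 \<Longrightarrow> \<tau> x > 0"
  using L w_pos by (simp add: \<tau>_def)

lemma \<tau>_eq: "x \<noteq> 0 \<Longrightarrow> 12 * L * norm x * \<tau> x = w (norm x) / 4"
  using L by (simp add: \<tau>_def)

lemma T_bounds:
  assumes "x \<noteq> 0"
  shows "0 \<le> T k x" "T k x \<le> 1"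
  using \<tau>_pos[OF assms] by (auto simp: T_def)

lemma damp_eq: "x \<noteq> 0 \<Longrightarrow> \<tau> x * damp k x = T (Suc k) x - T k x"
  using \<tau>_pos[of x] by (simp add: damp_def)

text \<open>The clipped time \<open>T k x\<close> is concave in \<open>k\<close>, so its increments
  decrease; this lets the drift of the next step be paid for by the damping of the current
  one.\<close>

lemma damp_bounds:
  assumes "x \<noteq> 0"
  shows "0 \<le> damp k x" "damp k x \<le> 1" "damp (Suc k) x \<le> damp k x"
proof -
  have "0 \<le> T (Suc k) x - T k x" "T (Suc k) x - T k x \<le> \<tau> x"
    "T (Suc (Suc k)) x - T (Suc k) x \<le> T (Suc k) x - T k x"
    using \<tau>_pos[OF assms] by (auto simp: T_def algebra_simps min_def)
  then show "0 \<le> damp k x" "damp k x \<le> 1" "damp (Suc k) x \<le> damp k x"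
    using \<tau>_pos[OF assms] by (auto simp: damp_def divide_le_eq_1 intro!: divide_right_mono)
qed

lemma norm_\<xi>_le:
  assumes "0 \<le> t" "t \<le> 1"
  shows "norm (\<xi> x t) \<le> norm x"
proof -
  have "norm (\<xi> x t) \<le> (1 - t) * norm x + t * norm x"
    using norm_triangle_ineq[of "((1 - t) * norm x) *\<^sub>R e" "t *\<^sub>R x"] assms
    by (simp add: \<xi>_def e abs_mult)
  then show ?thesis
    by (simp add: algebra_simps)
qed

lemma start_in_cball: "norm x \<le> R \<Longrightarrow> (norm x *\<^sub>R e, 0) \<in> cball 0 R"
  by (simp add: zero_prod_def dist_Pair_Pair e)

lemma start_bound: "norm x \<le> R \<Longrightarrow> norm (f (norm x *\<^sub>R e, 0)) \<le> L * norm x"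
  using f_bound[OF start_in_cball, of x] by (simp add: e norm_Pair)

lemma \<xi>_lipschitz: "norm (\<xi> x t' - \<xi> x t) \<le> 2 * norm x * \<bar>t' - t\<bar>"
proof -
  have "\<xi> x t' - \<xi> x t = (t' - t) *\<^sub>R (x - norm x *\<^sub>R e)"
    by (simp add: \<xi>_def algebra_simps)
  moreover have "norm (x - norm x *\<^sub>R e) \<le> 2 * norm x"
    using norm_triangle_ineq4[of x "norm x *\<^sub>R e"] by (simp add: e)
  ultimately show ?thesis
    using mult_left_mono[of "norm (x - norm x *\<^sub>R e)" "2 * norm x" "\<bar>t' - t\<bar>"]
    by (simp add: ac_simps)
qed

lemma target_lipschitz:
  assumes "norm x \<le> R"
  shows "norm (target x t' - target x t) \<le> 4 * L * norm x * \<bar>t' - t\<bar>"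
proof -
  have "target x t' - target x t = (t - t') *\<^sub>R (f (norm x *\<^sub>R e, 0) + (3 * L) *\<^sub>R x)"
    by (simp add: target_def algebra_simps)
  moreover have "norm (f (norm x *\<^sub>R e, 0) + (3 * L) *\<^sub>R x) \<le> 4 * L * norm x"
    using norm_triangle_ineq[of "f (norm x *\<^sub>R e, 0)" "(3 * L) *\<^sub>R x"] start_bound[OF assms] L
    by simp
  ultimately show ?thesis
    using mult_left_mono[of "norm (f (norm x *\<^sub>R e, 0) + (3 * L) *\<^sub>R x)" "4 * L * norm x" "\<bar>t - t'\<bar>"]
    by (simp add: ac_simps abs_minus_commute)
qed

text \<open>The segment from \<open>(|x| e, f (|x| e, 0))\<close> to \<open>(x, - 3 L x)\<close> stays away from the origin:
  its first component is small only for \<open>t\<close> near \<open>1/2\<close>, where the factor \<open>3 L\<close> makes the second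
  one large.\<close>

lemma norm_lower_bound:
  assumes t: "0 \<le> t" "t \<le> 1" and x: "norm x \<le> R" and z: "(\<xi> x t, v) \<in> cball 0 R"
    and res: "norm (target x t - f (\<xi> x t, v)) \<le> L * norm x / 4"
  shows "norm x / 4 \<le> norm (\<xi> x t, v)"
proof (cases "\<bar>1 - 2 * t\<bar> \<ge> 1/4")
  case True
  have "norm (\<xi> x t) \<ge> \<bar>(1 - t) * norm x - t * norm x\<bar>"
    using norm_triangle_ineq3[of "((1 - t) * norm x) *\<^sub>R e" "- (t *\<^sub>R x)"] t
    by (simp add: \<xi>_def e abs_mult)
  also have "(1 - t) * norm x - t * norm x = (1 - 2 * t) * norm x"
    by (simp add: algebra_simps)
  finally have "norm (\<xi> x t) \<ge> \<bar>1 - 2 * t\<bar> * norm x"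
    by (simp add: abs_mult)
  moreover have "1/4 * norm x \<le> \<bar>1 - 2 * t\<bar> * norm x"
    using True by (intro mult_right_mono) auto
  moreover have "norm (\<xi> x t) \<le> norm (\<xi> x t, v)"
    by (rule norm_fst_le)
  ultimately show ?thesis by simp
next
  case False
  then have t': "3/8 \<le> t"
    by linarith
  \<comment> \<open>At \<open>t \<ge> 3/8\<close> the factor \<open>4 * t - 1\<close> is at least
    1/2, so the target has norm at least \<open>L * norm x / 2\<close>; the residual can remove only
    half of that.\<close>
  have "L * norm x * (1/2) \<le> L * norm x * (4 * t - 1)"
    using t' L by (intro mult_left_mono) auto
  also have "\<dots> = 3 * L * t * norm x - (1 - t) * (L * norm x)"
    by (simp add: algebra_simps)
  also have "\<dots> \<le> norm ((3 * L * t) *\<^sub>R x) - norm ((1 - t) *\<^sub>R f (norm x *\<^sub>R e, 0))"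
    using start_bound[OF x] t L by (auto intro!: diff_mono mult_left_mono)
  also have "\<dots> \<le> norm (target x t)"
    unfolding target_def by (metis norm_minus_commute norm_triangle_ineq2)
  finally have "L * norm x / 4 \<le> norm (f (\<xi> x t, v))"
    using res norm_triangle_ineq2[of "target x t" "f (\<xi> x t, v)"] by linarith
  also have "\<dots> \<le> L * norm (\<xi> x t, v)"
    by (rule f_bound[OF z])
  finally show ?thesis
    using L by (simp add: field_simps)
qed

text \<open>\<open>C\<close> bounds \<open>G\<close> outside the ball of radius
  \<open>\<epsilon>/4\<close>. As the residual tolerance is
  \<open>12 * L * norm x * \<tau> x\<close>, the control there moves at speed at most
  \<open>12 * L * norm x * C\<close> in the segment parameter; the last clause says that unit time
  is too short to cross the shell between radii \<open>\<epsilon>/2\<close> and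
  \<open>\<epsilon>\<close>.\<close>

definition fits :: "real \<Rightarrow> real \<Rightarrow> real^'n \<Rightarrow> bool" where
  "fits \<epsilon> C x \<longleftrightarrow> 0 < \<epsilon> \<and> \<epsilon> \<le> R/4 \<and> 0 < C \<and> 0 < norm x \<and> norm x \<le> \<epsilon> \<and>
     (\<forall>z. \<epsilon>/4 \<le> norm z \<and> norm z \<le> R \<longrightarrow> norm (G z) \<le> C) \<and> 12 * L * norm x * C \<le> \<epsilon>/2"

section \<open>The invariant of the damped Newton iteration\<close>

lemma fits_exists:
  assumes "0 < \<epsilon>" "\<epsilon> \<le> R/4"
  obtains C \<delta> where "\<delta> > 0" "\<And>x. 0 < norm x \<Longrightarrow> norm x \<le> \<delta> \<Longrightarrow> fits \<epsilon> C x"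
proof -
  obtain C where C: "C > 0" "\<And>z. \<epsilon>/4 \<le> norm z \<Longrightarrow> norm z \<le> R \<Longrightarrow> norm (G z) \<le> C"
    using G_bounded[of "\<epsilon>/4"] assms(1) by auto
  show thesis
  proof (rule that[of "min \<epsilon> (\<epsilon> / (24 * L * C))" C])
    show "0 < min \<epsilon> (\<epsilon> / (24 * L * C))"
      using assms C(1) L by simp
    show "fits \<epsilon> C x" if "0 < norm x" "norm x \<le> min \<epsilon> (\<epsilon> / (24 * L * C))" for x
      using that assms C L by (auto simp: fits_def field_simps)
  qed
qed

text \<open>Admissibility makes \<open>w (norm x)\<close> small enough for
  \<open>norm_lower_bound\<close>; the resulting distance from the origin then lets admissibility be
  applied at the node itself.\<close>

lemma node_admissible:
  assumes x: "norm x \<le> R/4" "x \<noteq> 0" and v: "norm v \<le> R/4"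
    and res: "norm (resid k x v) \<le> w (norm x) / 4"
  shows "norm x / 4 \<le> norm (node k x v)" "norm (node k x v) \<le> R/2"
    "newton_radius (node k x v) (w (norm x))"
    "(norm (G (node k x v)) + 2) * w (norm x) \<le> norm x / 16"
proof -
  have w: "admissible (norm x / 4) (w (norm x))" "w (norm x) > 0"
    using w_admissible w_pos x(2) by auto
  have "norm (\<xi> x (T (Suc k) x)) \<le> R/4"
    using norm_\<xi>_le[of "T (Suc k) x" x] T_bounds[OF x(2), of "Suc k"] x(1) by simp
  then show le: "norm (node k x v) \<le> R/2"
    using v norm_Pair_le[of "\<xi> x (T (Suc k) x)" v] unfolding node_def by simp
  have "w (norm x) \<le> L * norm x / 4"
    using w(1) by (simp add: admissible_def)
  then have "norm (resid k x v) \<le> L * norm x / 4"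
    using res w(2) by linarith
  then show ge: "norm x / 4 \<le> norm (node k x v)"
    using le x(1) R unfolding node_def resid_def
    by (intro norm_lower_bound T_bounds x) auto
  show "newton_radius (node k x v) (w (norm x))"
    "(norm (G (node k x v)) + 2) * w (norm x) \<le> norm x / 16"
    using w(1) ge le unfolding admissible_def by (blast, fastforce)
qed

text \<open>With tolerance \<open>D\<close> and damping \<open>c\<close>, a step reduces the
  residual bound to \<open>(1 - c/2) * D\<close>, and the following drift adds at most
  \<open>D/2 * c\<close>, so \<open>D\<close> persists. The second bound is the shell
  argument.\<close>

lemma newton_invariant:
  assumes fits: "fits \<epsilon> C x"
  shows "norm (resid k x (newton k x)) \<le> w (norm x) / 4"
    "norm (newton k x) \<le> \<epsilon>/2 + 12 * L * norm x * C * T k x"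
proof -
  have x: "x \<noteq> 0" "norm x \<le> R/4" "norm x \<le> \<epsilon>" "norm x \<le> R" and \<epsilon>: "0 < \<epsilon>" "\<epsilon> \<le> R/4" and "C > 0"
    and C: "\<And>z. \<epsilon>/4 \<le> norm z \<Longrightarrow> norm z \<le> R \<Longrightarrow> norm (G z) \<le> C"
    and C': "12 * L * norm x * C \<le> \<epsilon>/2"
    using fits R by (auto simp: fits_def)
  define D where "D = w (norm x) / 4"
  have D: "D = 12 * L * norm x * \<tau> x" "D > 0"
    using \<tau>_eq[OF x(1)] w_pos x(1) by (simp_all add: D_def)
  have drift: "4 * L * norm x * \<bar>T (Suc k) x - T k x\<bar> + L * (2 * norm x * \<bar>T (Suc k) x - T k x\<bar>)
      = D / 2 * damp k x" for k
    using damp_eq[OF x(1), of k] damp_bounds[OF x(1), of k] \<tau>_pos[OF x(1)]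
    by (simp add: D(1) abs_of_nonneg flip: damp_eq[OF x(1)])
  have "norm (resid k x (newton k x)) \<le> D \<and>
      norm (newton k x) \<le> \<epsilon>/2 + 12 * L * norm x * C * T k x"
  proof (induction k)
    case 0
    \<comment> \<open>At time 0 the control 0 solves the equation exactly, so the first residual is
      pure drift.\<close>
    have "f (node 0 x 0) = f (\<xi> x (T 1 x), 0)" "target x (T 0 x) = f (\<xi> x (T 0 x), 0)"
      by (simp_all add: node_def target_def \<xi>_def T_def)
    then have "resid 0 x 0 = (target x (T 1 x) - target x (T 0 x)) -
        (f (\<xi> x (T 1 x), 0) - f (\<xi> x (T 0 x), 0))"
      by (simp add: resid_def)
    also have "norm \<dots> \<le> 4 * L * norm x * \<bar>T 1 x - T 0 x\<bar> + L * (2 * norm x * \<bar>T 1 x - T 0 x\<bar>)"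
    proof (rule order_trans[OF norm_triangle_ineq4 add_mono[OF target_lipschitz[OF x(4)]]])
      have "(\<xi> x (T k x), 0 :: real^'m) \<in> cball 0 R" for k
        using norm_\<xi>_le[of "T k x" x] T_bounds[OF x(1), of k] x by (simp add: norm_Pair)
      then have "norm (f (\<xi> x (T 1 x), 0) - f (\<xi> x (T 0 x), 0)) \<le>
          L * norm ((\<xi> x (T 1 x), 0 :: real^'m) - (\<xi> x (T 0 x), 0))"
        by (intro f_lipschitz)
      also have "\<dots> \<le> L * (2 * norm x * \<bar>T 1 x - T 0 x\<bar>)"
        using \<xi>_lipschitz[of x] L by (intro mult_left_mono) (auto simp: norm_Pair)
      finally show "norm (f (\<xi> x (T 1 x), 0) - f (\<xi> x (T 0 x), 0)) \<le>
          L * (2 * norm x * \<bar>T 1 x - T 0 x\<bar>)" .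
    qed
    also have "\<dots> = D / 2 * damp 0 x"
      using drift[of 0] by simp
    also have "\<dots> \<le> D"
      using D(2) damp_bounds[OF x(1), of 0] mult_left_le[of "damp 0 x" "D/2"] by linarith
    finally show ?case
      using \<epsilon> by (simp add: T_def)
  next
    case (Suc k)
    let ?u = "newton k x" and ?u' = "newton (Suc k) x"
    define z where "z = node k x ?u"
    define d where "d = resid k x ?u"
    define c where "c = damp k x"
    have c: "0 \<le> c" "c \<le> 1" "damp (Suc k) x \<le> c"
      using damp_bounds[OF x(1)] by (auto simp: c_def)
    have u: "norm ?u \<le> \<epsilon>/2 + 12 * L * norm x * C * T k x" and d: "norm d \<le> D"
      using Suc by (auto simp: d_def)
    have step: "12 * L * norm x * C * T k x \<le> \<epsilon>/2" for k
    proof -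
      have "12 * L * norm x * C * T k x \<le> 12 * L * norm x * C * 1"
        using L \<open>C > 0\<close> T_bounds[OF x(1)] by (intro mult_left_mono) auto
      then show ?thesis
        using C' by simp
    qed
    have u4: "norm ?u \<le> R/4"
      using u step[of k] \<epsilon> by linarith
    have z: "norm x / 4 \<le> norm z" "norm z \<le> R/2" "newton_radius z (w (norm x))"
      "(norm (G z) + 2) * w (norm x) \<le> norm x / 16"
      using node_admissible[OF x(2,1) u4] d by (auto simp: z_def d_def D_def)
    have u': "?u' = ?u + G z *v (c *\<^sub>R d)"
      by (simp add: z_def d_def c_def matrix_vector_mult_scaleR)
    have cd: "norm (c *\<^sub>R d) \<le> c * D"
      using c d by (simp add: mult_left_mono)
    have "c * D \<le> 1 * D"
      using c D(2) by (intro mult_right_mono) auto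
    then have cD: "c * D \<le> w (norm x)"
      using D(2) unfolding D_def by linarith
    then have cd': "norm (c *\<^sub>R d) \<le> w (norm x)"
      using cd by linarith
    have G: "norm (G z *v (c *\<^sub>R d)) \<le> norm (G z) * (c * D)"
      using norm_matrix_vector_mult_le[of "G z" "c *\<^sub>R d"] cd
      by (meson mult_left_mono norm_ge_zero order_trans)
    have bound: "norm ?u' \<le> \<epsilon>/2 + 12 * L * norm x * C * T (Suc k) x"
    \<comment> \<open>Outside the small ball \<open>C\<close> bounds the speed. Inside it
      \<open>C\<close> says nothing about \<open>G z\<close>, but admissibility makes the step so
      short that the control stays below \<open>\<epsilon>/2\<close>.\<close>
    proof (cases "\<epsilon>/4 \<le> norm z")
      case True
      have "norm (G z) * (c * D) \<le> C * (c * D)"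
        using C[OF True] z(2) R c D(2) by (intro mult_right_mono) auto
      also have "\<dots> = 12 * L * norm x * C * (T (Suc k) x - T k x)"
        by (simp add: D(1) c_def flip: damp_eq[OF x(1)])
      finally show ?thesis
        using u G norm_triangle_ineq[of ?u "G z *v (c *\<^sub>R d)"] unfolding u'
        by (simp add: algebra_simps)
    next
      case False
      have "norm ?u \<le> norm z"
        unfolding z_def node_def by (rule norm_snd_le)
      then have "norm ?u \<le> \<epsilon>/4"
        using False by simp
      moreover have "norm (G z) * (c * D) \<le> (norm (G z) + 2) * w (norm x)"
        using c D(2) cD by (intro mult_mono) auto
      then have "norm (G z *v (c *\<^sub>R d)) \<le> \<epsilon>/4"
        using G z(4) x(3) \<epsilon>(1) by linarith
      ultimately have "norm ?u' \<le> \<epsilon>/2"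
        using norm_triangle_ineq[of ?u "G z *v (c *\<^sub>R d)"] unfolding u' by linarith
      moreover have "0 \<le> 12 * L * norm x * C * T (Suc k) x"
        using L \<open>C > 0\<close> T_bounds[OF x(1)] by simp
      ultimately show ?thesis by linarith
    qed
    have zz: "z = (\<xi> x (T (Suc k) x), ?u)"
      by (simp add: z_def node_def)
    \<comment> \<open>\<open>q\<close> is the residual after the correction but before time
      advances; \<open>err\<close> is its nonlinear part, bounded by comparing the coordinates
      \<open>c *\<^sub>R d\<close> and 0 in the Newton contraction.\<close>
    define q where "q = target x (T (Suc k) x) - f (\<xi> x (T (Suc k) x), ?u')"
    define err where "err = c *\<^sub>R d - f (\<xi> x (T (Suc k) x), ?u') - (- f z)"
    have err: "norm err \<le> c * norm d / 2"
      using newton_contraction[OF z(3), of 0 "G z" "c *\<^sub>R d" 0] cd' w_pos[of "norm x"] x(1) c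
      unfolding u' err_def zz by simp
    have "q = (1 - c) *\<^sub>R d + err"
      by (simp add: q_def err_def d_def resid_def z_def algebra_simps)
    then have "norm q \<le> (1 - c) * norm d + c * norm d / 2"
      using err c norm_triangle_ineq[of "(1 - c) *\<^sub>R d" err] by simp
    also have "\<dots> = (1 - c / 2) * norm d"
      by (simp add: algebra_simps)
    also have "\<dots> \<le> (1 - c / 2) * D"
      using c d by (intro mult_left_mono) auto
    finally have q: "norm q \<le> (1 - c / 2) * D" .
    have in_ball: "(\<xi> x (T j x), ?u') \<in> cball 0 R" for j
    proof -
      have "norm (\<xi> x (T j x), ?u') \<le> norm (\<xi> x (T j x)) + norm ?u'"
        by (rule norm_Pair_le)
      also have "\<dots> \<le> R/4 + R/4"
        using norm_\<xi>_le[of "T j x" x] T_bounds[OF x(1), of j] x bound step[of "Suc k"] \<epsilon>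
        by (intro add_mono) auto
      finally show ?thesis
        using R by simp
    qed
    \<comment> \<open>Only the time changes between these two residuals, so their difference is
      drift.\<close>
    have "resid (Suc k) x ?u' - q =
        (target x (T (Suc (Suc k)) x) - target x (T (Suc k) x)) -
        (f (\<xi> x (T (Suc (Suc k)) x), ?u') - f (\<xi> x (T (Suc k) x), ?u'))"
      by (simp only: resid_def q_def node_def) simp
    also have "norm \<dots> \<le> 4 * L * norm x * \<bar>T (Suc (Suc k)) x - T (Suc k) x\<bar> +
        L * (2 * norm x * \<bar>T (Suc (Suc k)) x - T (Suc k) x\<bar>)"
    proof (rule order_trans[OF norm_triangle_ineq4 add_mono[OF target_lipschitz[OF x(4)]]])
      have "norm (f (\<xi> x (T (Suc (Suc k)) x), ?u') - f (\<xi> x (T (Suc k) x), ?u')) \<le>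
          L * norm ((\<xi> x (T (Suc (Suc k)) x), ?u') - (\<xi> x (T (Suc k) x), ?u'))"
        by (intro f_lipschitz in_ball)
      also have "\<dots> \<le> L * (2 * norm x * \<bar>T (Suc (Suc k)) x - T (Suc k) x\<bar>)"
        using \<xi>_lipschitz[of x] L by (intro mult_left_mono) (auto simp: norm_Pair)
      finally show "norm (f (\<xi> x (T (Suc (Suc k)) x), ?u') - f (\<xi> x (T (Suc k) x), ?u')) \<le>
          L * (2 * norm x * \<bar>T (Suc (Suc k)) x - T (Suc k) x\<bar>)" .
    qed
    also have "\<dots> = D / 2 * damp (Suc k) x"
      by (rule drift)
    also have "\<dots> \<le> D / 2 * c"
      using c D(2) by (intro mult_left_mono) auto
    finally have "norm (resid (Suc k) x ?u') \<le> (1 - c / 2) * D + D / 2 * c"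
      using q norm_triangle_sub[of "resid (Suc k) x ?u'" q] by linarith
    then have "norm (resid (Suc k) x ?u') \<le> D"
      by (simp add: algebra_simps)
    then show ?case
      using bound by blast
  qed
  then show "norm (resid k x (newton k x)) \<le> w (norm x) / 4"
    "norm (newton k x) \<le> \<epsilon>/2 + 12 * L * norm x * C * T k x"
    by (auto simp: D_def)
qed

lemma newton_bound:
  assumes fits: "fits \<epsilon> C x"
  shows "norm (newton k x) \<le> \<epsilon>"
proof -
  have "12 * L * norm x * C * T k x \<le> 12 * L * norm x * C * 1"
    using fits L T_bounds[of x k] by (intro mult_left_mono) (auto simp: fits_def)
  then show ?thesis
    using newton_invariant(2)[OF fits, of k] fits by (simp add: fits_def)
qed

section \<open>Continuous dependence of the iterates on the state\<close>

lemma continuous_on_norm_comp: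
  assumes "continuous_on {0<..} h" "0 \<notin> S"
  shows "continuous_on S (\<lambda>x. h (norm x))"
  using assms(2) by (intro continuous_on_compose2[OF assms(1)] continuous_intros) auto

lemma continuous_\<tau>: "0 \<notin> S \<Longrightarrow> continuous_on S \<tau>"
  unfolding \<tau>_def using L
  by (intro continuous_intros continuous_on_norm_comp w_cont) auto

lemma continuous_T: "0 \<notin> S \<Longrightarrow> continuous_on S (T k)"
  unfolding T_def[abs_def] by (intro continuous_intros continuous_\<tau>)

text \<open>The invariant keeps every node inside the punctured ball, where \<open>G\<close> is
  continuous, so continuity passes from one iterate to the next.\<close>

lemma continuous_newton:
  assumes S: "\<And>x. x \<in> S \<Longrightarrow> fits \<epsilon> C x"
  shows "continuous_on S (newton k)"
proof (induction k)
  case (Suc k)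
  have x: "norm x \<le> R/4" "norm x \<le> R" "x \<noteq> 0" "norm (newton k x) \<le> R/4" if "x \<in> S" for x
    using S[OF that] newton_bound[OF S[OF that], of k] R by (auto simp: fits_def)
  have node: "node k x (newton k x) \<in> cball 0 R - {0}" if "x \<in> S" for x
    using node_admissible(1,2)[OF x(1,3,4)[OF that] newton_invariant(1)[OF S[OF that]]] x(3)[OF that] R
    by auto
  have 0: "0 \<notin> S"
    using S by (auto simp: fits_def)
  have ne: "\<tau> x \<noteq> 0" if "x \<in> S" for x
    using \<tau>_pos[OF x(3)[OF that]] by simp
  have contT: "continuous_on S (T j)" for j
    by (rule continuous_T[OF 0])
  have cont_node: "continuous_on S (\<lambda>x. node k x (newton k x))"
    unfolding node_def \<xi>_def by (intro continuous_intros contT Suc)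
  have cont_f: "continuous_on S (\<lambda>x. f (node k x (newton k x)))"
    using node by (intro continuous_on_compose2[OF cont_f cont_node]) auto
  have cont_G: "continuous_on S (\<lambda>x. G (node k x (newton k x)))"
    using node by (intro continuous_on_compose2[OF contG cont_node]) auto
  have cont_start: "continuous_on S (\<lambda>x. f (norm x *\<^sub>R e, 0))"
    using start_in_cball x(2)
    by (intro continuous_on_compose2[OF punctured_submersion.cont_f[OF punctured_submersion_axioms]]
        continuous_intros) blast
  have "continuous_on S (\<lambda>x. resid k x (newton k x))"
    unfolding resid_def target_def by (intro continuous_intros contT cont_f cont_start)
  then show ?case
    unfolding newton.simps damp_def
    by (intro continuous_intros bounded_bilinear.continuous_on[OF bounded_bilinear_matrix_vector_mult]
        cont_G Suc contT continuous_\<tau>[OF 0]) (use ne in auto)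
qed simp

definition stop :: "real^'n \<Rightarrow> nat" where
  "stop x = nat \<lceil>1 / \<tau> x\<rceil>"

lemma T_stop:
  assumes "x \<noteq> 0" "1 / \<tau> x \<le> real k"
  shows "T k x = 1"
  using assms \<tau>_pos[OF assms(1)] by (simp add: T_def field_simps)

lemma newton_stop:
  assumes "x \<noteq> 0" "1 / \<tau> x \<le> real k"
  shows "newton k x = newton (stop x) x"
proof -
  have "real (stop x) \<ge> 1 / \<tau> x" "stop x \<le> k"
    using assms(2) by (auto simp: stop_def ceiling_le_iff nat_le_iff real_nat_ceiling_ge)
  moreover from this(2) have "1 / \<tau> x \<le> real (stop x) \<Longrightarrow> ?thesis"
  proof (induction k rule: dec_induct)
    case (step j)
    have "1 / \<tau> x \<le> real j" "1 / \<tau> x \<le> real (Suc j)"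
      using step by auto
    then have "damp j x = 0"
      using T_stop[OF assms(1)] by (simp add: damp_def)
    then show ?case
      using step by simp
  qed simp
  ultimately show ?thesis by blast
qed

lemma approximate_section:
  obtains u s where "0 < s" "s \<le> R/4" "continuous_on (cball 0 s - {0}) u"
    "\<And>x. x \<in> cball 0 s - {0} \<Longrightarrow> norm (u x) \<le> R/4"
    "\<And>x. x \<in> cball 0 s - {0} \<Longrightarrow> norm (f (x, u x) + (3 * L) *\<^sub>R x) \<le> w (norm x) / 4"
    "(u \<longlongrightarrow> 0) (at 0)"
proof -
  obtain C s where s: "s > 0" "\<And>x. 0 < norm x \<Longrightarrow> norm x \<le> s \<Longrightarrow> fits (R/4) C x"
    by (rule fits_exists[of "R/4"]) (use R in auto)
  define X where "X = {x :: real^'n. 0 < norm x \<and> norm x < s}"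
  define u where "u x = newton (stop x) x" for x
  have fitX: "fits (R/4) C x" if "x \<in> cball 0 s - {0}" for x
    using that s(2) by auto
  have lim: "real (stop x) \<ge> 1 / \<tau> x" for x
    by (simp add: stop_def real_nat_ceiling_ge)
  show thesis
  \<comment> \<open>Halving \<open>s\<close> places the closed punctured ball inside the open set
    \<open>X\<close>, on which continuity is checked pointwise.\<close>
  proof (rule that[of "min (s/2) (R/4)" u])
    show "0 < min (s/2) (R/4)" "min (s/2) (R/4) \<le> R/4"
      using s(1) R by auto
    have "isCont u x0" if x0: "x0 \<in> X" for x0 :: "real^'n"
    proof -
      have 0: "x0 \<noteq> 0"
        using x0 by (auto simp: X_def)
      have "open X"
        unfolding X_def by (intro open_Collect_conj open_Collect_less continuous_intros)
      have cont\<tau>: "continuous_on X \<tau>"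
        by (rule continuous_\<tau>) (simp add: X_def)
      \<comment> \<open>\<open>stop\<close> itself may jump, but a fixed \<open>k\<close> beyond
        \<open>1 / \<tau> x0\<close> is also beyond \<open>1 / \<tau> x\<close> for \<open>x\<close>
        near \<open>x0\<close>, so \<open>u\<close> locally coincides with
        \<open>newton k\<close>.\<close>
      obtain k where k: "1 / \<tau> x0 < real k"
        using reals_Archimedean2 by blast
      have "isCont \<tau> x0"
        using cont\<tau> \<open>open X\<close> x0 continuous_on_eq_continuous_at by blast
      then have "isCont (\<lambda>x. 1 / \<tau> x) x0"
        using \<tau>_pos[OF 0] by (intro continuous_intros) auto
      then have "((\<lambda>x. 1 / \<tau> x) \<longlongrightarrow> 1 / \<tau> x0) (nhds x0)"
        using tendsto_at_iff_tendsto_nhds[of "\<lambda>x. 1 / \<tau> x" x0] by (simp add: isCont_def)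
      then have "\<forall>\<^sub>F x in nhds x0. 1 / \<tau> x < real k"
        using k by (rule order_tendstoD)
      moreover have "\<forall>\<^sub>F x in nhds x0. x \<in> X"
        using \<open>open X\<close> x0 by (rule eventually_nhds_in_open)
      ultimately have ev: "\<forall>\<^sub>F x in nhds x0. newton k x = u x"
        by eventually_elim (auto simp: u_def X_def intro!: newton_stop)
      have "continuous_on X (newton k)"
        by (rule continuous_newton[of _ "R/4" C]) (auto simp: X_def s)
      then have "isCont (newton k) x0"
        using \<open>open X\<close> x0 continuous_on_eq_continuous_at by blast
      then show ?thesis
        using isCont_cong[OF ev] by blast
    qed
    then show "continuous_on (cball 0 (min (s/2) (R/4)) - {0}) u"
      using s(1) by (intro continuous_at_imp_continuous_on) (auto simp: X_def)
  next
    fix x :: "real^'n" assume "x \<in> cball 0 (min (s/2) (R/4)) - {0}"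
    then have x: "x \<in> cball 0 s - {0}" "x \<noteq> 0"
      using s(1) by auto
    show "norm (u x) \<le> R/4"
      using newton_bound[OF fitX[OF x(1)]] by (simp add: u_def)
    \<comment> \<open>At time 1 the segment has reached \<open>x\<close> and the target is
      \<open>- (3 * L) *\<^sub>R x\<close>, so the last residual is the defect up to sign.\<close>
    have "T (Suc (stop x)) x = 1"
      using lim[of x] by (intro T_stop x) simp
    then have "f (x, u x) + (3 * L) *\<^sub>R x = - resid (stop x) x (newton (stop x) x)"
      by (simp add: resid_def u_def target_def node_def \<xi>_def)
    then show "norm (f (x, u x) + (3 * L) *\<^sub>R x) \<le> w (norm x) / 4"
      using newton_invariant(1)[OF fitX[OF x(1)]] by simp
  next
    show "(u \<longlongrightarrow> 0) (at 0)"
    proof (rule tendstoI)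
      fix \<epsilon> :: real assume "\<epsilon> > 0"
      \<comment> \<open>The iteration does not involve the shell radius, so the same iterates obey
        the bound for every smaller radius once \<open>x\<close> is small enough.\<close>
      define \<epsilon>' where "\<epsilon>' = min (\<epsilon>/2) (R/4)"
      have "0 < \<epsilon>'" "\<epsilon>' \<le> R/4" "\<epsilon>' < \<epsilon>"
        using \<open>\<epsilon> > 0\<close> R by (auto simp: \<epsilon>'_def)
      then obtain C' \<delta> where \<delta>: "\<delta> > 0"
        "\<And>x. 0 < norm x \<Longrightarrow> norm x \<le> \<delta> \<Longrightarrow> fits \<epsilon>' C' x"
        using fits_exists by blast
      have "dist (u x) 0 < \<epsilon>" if "x \<noteq> 0" "dist x 0 < \<delta>" for x
        using newton_bound[OF \<delta>(2), of x "stop x"] that \<open>\<epsilon>' < \<epsilon>\<close> by (simp add: u_def)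
      then show "\<forall>\<^sub>F x in at 0. dist (u x) 0 < \<epsilon>"
        using \<delta>(1) unfolding eventually_at by blast
    qed
  qed
qed

end

section \<open>The differentiable section\<close>

context newton_continuation
begin

text \<open>An approximate section is replaced by a differentiable one \<open>v\<close>, the right inverse \<open>G\<close> along it
  by a differentiable \<open>M\<close>; the remaining error is removed by the contraction
  \<open>a \<mapsto> a - (f (x, v x + M x a) + 3 L x)\<close>.\<close>

lemma differentiable_section:
  obtains u r where "r > 0" "\<And>x. x \<in> ball 0 r - {0} \<Longrightarrow> u differentiable (at x)"
    "\<And>x. x \<in> ball 0 r - {0} \<Longrightarrow> (x, u x) \<in> cball 0 R"
    "\<And>x. x \<in> ball 0 r - {0} \<Longrightarrow> f (x, u x) = - (3 * L) *\<^sub>R x"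
    "(u \<longlongrightarrow> 0) (at 0)"
proof -
  obtain u0 s where s: "0 < s" "s \<le> R/4" and cont_u0: "continuous_on (cball 0 s - {0}) u0"
    and u0_bound: "\<And>x. x \<in> cball 0 s - {0} \<Longrightarrow> norm (u0 x) \<le> R/4"
    and u0: "\<And>x. x \<in> cball 0 s - {0} \<Longrightarrow> norm (f (x, u0 x) + (3 * L) *\<^sub>R x) \<le> w (norm x) / 4"
    and u0_lim: "(u0 \<longlongrightarrow> 0) (at 0)"
    using approximate_section by metis
  define W where "W = cball (0::real^'n) s - {0}"
  \<comment> \<open>This accuracy keeps the approximations within the slack
    \<open>w (norm x)\<close> of the Newton radius, changes \<open>f\<close> by at most
    \<open>w (norm x) / 8\<close>, and changes \<open>G\<close> by at most 1.\<close>
  define \<eta> where "\<eta> x = min 1 (w (norm x) / (8 * (L + 1)))" for x :: "real^'n"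
  have node: "norm (x, u0 x) \<le> R/2" "norm x / 4 \<le> norm (x, u0 x)" if "x \<in> W" for x
  proof -
    have "norm (x, u0 x) \<le> norm x + norm (u0 x)"
      by (rule norm_Pair_le)
    then show "norm (x, u0 x) \<le> R/2"
      using that s(2) u0_bound[of x] by (simp add: W_def)
    show "norm x / 4 \<le> norm (x, u0 x)"
      using norm_fst_le[of x "u0 x"] norm_ge_zero[of x] by linarith
  qed
  have rad: "newton_radius (x, u0 x) (w (norm x))"
      "(norm (G (x, u0 x)) + 2) * w (norm x) \<le> norm x / 16" if "x \<in> W" for x
    using w_admissible[of "norm x"] node[OF that] that unfolding admissible_def
    by (auto simp: W_def)
  have "continuous_on W (\<lambda>x. (u0 x, G (x, u0 x)))"
  proof (intro continuous_intros continuous_on_compose2[OF contG])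
    show "(\<lambda>x. (x, u0 x)) ` W \<subseteq> cball 0 R - {0}"
    proof (rule image_subsetI)
      fix x assume "x \<in> W"
      moreover from this have "(x, u0 x) \<noteq> 0"
        by (simp add: W_def zero_prod_def)
      ultimately show "(x, u0 x) \<in> cball 0 R - {0}"
        using node(1)[of x] R by simp
    qed
  qed (use cont_u0 in \<open>auto simp: W_def\<close>)
  moreover have "continuous_on W \<eta>"
    unfolding \<eta>_def using L
    by (intro continuous_intros continuous_on_norm_comp w_cont) (auto simp: W_def)
  moreover have \<eta>_pos: "\<eta> x > 0" if "x \<in> W" for x
    using that L w_pos by (simp add: \<eta>_def W_def)
  ultimately obtain g where g: "\<And>x. x \<noteq> 0 \<Longrightarrow> g differentiable (at x)"
      "\<And>x. x \<in> W \<Longrightarrow> norm (g x - (u0 x, G (x, u0 x))) \<le> \<eta> x"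
    using smooth_approximation_punctured[of s "\<lambda>x. (u0 x, G (x, u0 x))" \<eta>, folded W_def] by blast
  define v where "v x = fst (g x)" for x
  define M where "M x = snd (g x)" for x
  have dv: "v differentiable (at x)" and dM: "M differentiable (at x)" if "x \<noteq> 0" for x
    using g(1)[OF that] unfolding v_def M_def differentiable_def
    by (blast intro: has_derivative_fst has_derivative_snd)+
  have \<eta>_le: "\<eta> x \<le> w (norm x)" "L * \<eta> x \<le> w (norm x) / 8" "\<eta> x \<le> 1" if "x \<in> W" for x
  proof -
    have "\<eta> x \<le> w (norm x) / (8 * (L + 1))"
      by (simp add: \<eta>_def)
    then have 1: "8 * (\<eta> x + L * \<eta> x) \<le> w (norm x)"
      using L by (simp add: pos_le_divide_eq algebra_simps)
    have "0 < \<eta> x" "0 < L * \<eta> x"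
      using \<eta>_pos[OF that] L by simp_all
    with 1 show "\<eta> x \<le> w (norm x)" "L * \<eta> x \<le> w (norm x) / 8"
      by (simp_all add: algebra_simps)
  qed (simp add: \<eta>_def)
  have v: "norm (v x - u0 x) \<le> \<eta> x" and M: "norm (M x - G (x, u0 x)) \<le> \<eta> x" if "x \<in> W" for x
    using g(2)[OF that] norm_fst_le[of "v x - u0 x" "M x - G (x, u0 x)"]
      norm_snd_le[of "M x - G (x, u0 x)" "v x - u0 x"]
    by (simp_all add: v_def M_def minus_prod_def)
  have vw: "norm (v x - u0 x) \<le> w (norm x)" and Mw: "norm (M x - G (x, u0 x)) \<le> w (norm x)"
    if "x \<in> W" for x
    using v[OF that] M[OF that] \<eta>_le(1)[OF that] by linarith+
  define \<Phi> where "\<Phi> = (\<lambda>(x, a). f (x, v x + M x *v a) + (3 * L) *\<^sub>R x)"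
  have contr: "norm ((a - \<Phi> (x, a)) - (b - \<Phi> (x, b))) \<le> norm (a - b) / 2"
    if "x \<in> W" "norm a \<le> w (norm x)" "norm b \<le> w (norm x)" for x a b
  proof -
    have eq: "(a - \<Phi> (x, a)) - (b - \<Phi> (x, b)) =
        (a - f (x, v x + M x *v a)) - (b - f (x, v x + M x *v b))"
      by (simp add: \<Phi>_def)
    show ?thesis
      unfolding eq
      using newton_contraction[OF rad(1)[OF that(1)] vw[OF that(1)] Mw[OF that(1)] that(2,3)]
      by simp
  qed
  have in_ball: "(x, v x + M x *v a) \<in> cball 0 R"
      "norm (d - f' (x, v x + M x *v a) (0, M x *v d)) \<le> norm d / 2"
    if "x \<in> W" "norm a \<le> w (norm x)" for x a d
    using newton_radiusD[OF rad(1)[OF that(1)] vw[OF that(1)] Mw[OF that(1)] that(2)] by simp_all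
  \<comment> \<open>3/8 is 1/8 from smoothing the control plus 1/4 from the residual of the
    approximate section.\<close>
  have \<Phi>0: "norm (\<Phi> (x, 0)) \<le> 3/8 * w (norm x)" if "x \<in> W" for x
  proof -
    have "(x, v x) \<in> cball 0 R" "(x, u0 x) \<in> cball 0 R"
      using in_ball(1)[OF that, of 0] node(1)[OF that] R w_pos[of "norm x"] that
      by (auto simp: W_def)
    then have "norm (f (x, v x) - f (x, u0 x)) \<le> L * norm ((x, v x) - (x, u0 x))"
      by (rule f_lipschitz)
    also have "\<dots> \<le> L * \<eta> x"
      using v[OF that] L by (intro mult_left_mono) (auto simp: norm_Pair)
    also have "\<dots> \<le> w (norm x) / 8"
      by (rule \<eta>_le[OF that])
    finally have "norm (f (x, v x) - f (x, u0 x)) \<le> w (norm x) / 8" .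
    moreover have "\<Phi> (x, 0) = (f (x, v x) - f (x, u0 x)) + (f (x, u0 x) + (3 * L) *\<^sub>R x)"
      by (simp add: \<Phi>_def)
    ultimately show ?thesis
      using u0[of x] that norm_triangle_ineq[of "f (x, v x) - f (x, u0 x)" "f (x, u0 x) + (3 * L) *\<^sub>R x"]
      unfolding W_def by simp
  qed
  have "\<exists>a. norm a < w (norm x) \<and> \<Phi> (x, a) = 0" if "x \<in> W" for x
  proof -
    have w: "w (norm x) > 0"
      using w_pos that by (simp add: W_def)
    have step: "norm (a - \<Phi> (x, a)) \<le> 3/8 * w (norm x) + norm a / 2" if "norm a \<le> w (norm x)" for a
      using contr[OF \<open>x \<in> W\<close> that, of 0] \<Phi>0[OF \<open>x \<in> W\<close>] w
        norm_triangle_ineq4[of "a - \<Phi> (x, a) + \<Phi> (x, 0)" "\<Phi> (x, 0)"] by simp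
    have "\<exists>!a\<in>cball 0 (w (norm x)). a - \<Phi> (x, a) = a"
    \<comment> \<open>The ball is mapped into itself because 3/8 + 1/2 < 1. A fixed point then has
      norm at most 3/4 of \<open>w (norm x)\<close>, which gives the strict bound.\<close>
    proof (rule Banach_fix[where c = "1/2"])
      show "(\<lambda>a. a - \<Phi> (x, a)) ` cball 0 (w (norm x)) \<subseteq> cball 0 (w (norm x))"
      proof safe
        fix a :: "real^'n" assume "a \<in> cball 0 (w (norm x))"
        then have "norm a \<le> w (norm x)"
          by simp
        then show "a - \<Phi> (x, a) \<in> cball 0 (w (norm x))"
          using step[of a] w unfolding mem_cball_0 by linarith
      qed
    qed (use w contr[OF that] in \<open>auto simp: dist_norm complete_eq_closed\<close>)
    then obtain a where a: "norm a \<le> w (norm x)" "a - \<Phi> (x, a) = a"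
      by auto
    then have "norm a \<le> 3/8 * w (norm x) + norm a / 2"
      using step[OF a(1)] by simp
    then show ?thesis
      using a w by (intro exI[of _ a]) auto
  qed
  then obtain a where a: "\<And>x. x \<in> W \<Longrightarrow> norm (a x) < w (norm x)" "\<And>x. x \<in> W \<Longrightarrow> \<Phi> (x, a x) = 0"
    by metis
  define u where "u x = v x + M x *v a x" for x
  have da: "a differentiable (at x)" if x: "x \<in> ball 0 s - {0}" for x
  proof -
    have xW: "x \<in> W" and "x \<noteq> 0"
      using x by (auto simp: W_def)
    obtain v' M' where v': "(v has_derivative v') (at x)" and M': "(M has_derivative M') (at x)"
      using dv dM \<open>x \<noteq> 0\<close> unfolding differentiable_def by metis
    let ?p = "(x, a x)" and ?q = "(x, v x + M x *v a x)"
    have ax: "norm (a x) \<le> w (norm x)"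
      using a(1)[OF xW] by simp
    have D1: "((\<lambda>p. v (fst p)) has_derivative (\<lambda>h. v' (fst h))) (at ?p)"
      using has_derivative_compose[OF has_derivative_fst[OF has_derivative_ident], of v v' ?p] v' by simp
    have D2: "((\<lambda>p. M (fst p)) has_derivative (\<lambda>h. M' (fst h))) (at ?p)"
      using has_derivative_compose[OF has_derivative_fst[OF has_derivative_ident], of M M' ?p] M' by simp
    have D3: "((\<lambda>p. M (fst p) *v snd p) has_derivative
        (\<lambda>h. M x *v snd h + M' (fst h) *v a x)) (at ?p)"
      using bounded_bilinear.FDERIV[OF bounded_bilinear_matrix_vector_mult D2
          has_derivative_snd[OF has_derivative_ident]] by simp
    let ?s = "\<lambda>p. (fst p, v (fst p) + M (fst p) *v snd p)"
    let ?s' = "\<lambda>h. (fst h, v' (fst h) + (M x *v snd h + M' (fst h) *v a x))"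
    have D4: "(?s has_derivative ?s') (at ?p)"
      by (intro has_derivative_Pair has_derivative_add D1 D3 has_derivative_fst has_derivative_ident)
    have "(f has_derivative f' (?s ?p)) (at (?s ?p))"
      using der[OF in_ball(1)[OF xW ax]] by simp
    from has_derivative_compose[OF D4 this]
    have "((\<lambda>p. f (?s p)) has_derivative (\<lambda>h. f' ?q (?s' h))) (at ?p)"
      by simp
    then have D: "(\<Phi> has_derivative (\<lambda>h. f' ?q (fst h, v' (fst h) + (M x *v snd h + M' (fst h) *v a x))
        + (3 * L) *\<^sub>R fst h)) (at ?p)"
      unfolding \<Phi>_def case_prod_beta by (intro derivative_intros)
    have nhd: "\<forall>\<^sub>F y in nhds x. y \<in> ball 0 s - {0}"
      using x by (intro eventually_nhds_in_open) auto
    have zero: "\<forall>\<^sub>F y in nhds x. \<Phi> (y, a y) = 0"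
      using nhd by eventually_elim (intro a(2), auto simp: W_def)
    have "continuous_on (ball 0 s - {0}) (\<lambda>y :: real^'n. w (norm y))"
      by (intro continuous_on_norm_comp w_cont) auto
    moreover have "open (ball (0 :: real^'n) s - {0})"
      by (intro open_delete open_ball)
    ultimately have "isCont (\<lambda>y. w (norm y)) x"
      using x continuous_on_eq_continuous_at by blast
    then have "((\<lambda>y. w (norm y)) \<longlongrightarrow> w (norm x)) (nhds x)"
      using tendsto_at_iff_tendsto_nhds[of "\<lambda>y. w (norm y)" x] by (simp add: isCont_def)
    \<comment> \<open>Strictness and continuity of \<open>w\<close> keep \<open>a x\<close> inside
      the ball of contraction belonging to each nearby \<open>y\<close>.\<close>
    then have "\<forall>\<^sub>F y in nhds x. norm (a x) < w (norm y)"
      using a(1)[OF xW] by (rule order_tendstoD)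
    with nhd have contr': "\<forall>\<^sub>F y in nhds x.
        norm ((a y - \<Phi> (y, a y)) - (a x - \<Phi> (y, a x))) \<le> norm (a y - a x) / 2"
    proof eventually_elim
      case (elim y)
      then have "y \<in> W"
        by (auto simp: W_def)
      then show ?case
        using elim a(1)[of y] by (intro contr) auto
    qed
    show ?thesis
    proof (rule differentiable_implicit_zero[OF D zero contr'])
      fix d
      have "v' 0 = 0" "M' 0 = 0"
        using v' M' by (auto intro: linear_0 has_derivative_linear)
      then show "norm (d - (f' ?q (fst (0, d), v' (fst (0::real^'n, d)) +
          (M x *v snd (0::real^'n, d) + M' (fst (0::real^'n, d)) *v a x)) + (3 * L) *\<^sub>R fst (0, d)))
          \<le> norm d / 2"
        using in_ball(2)[OF xW ax, of d] by simp
    qed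
  qed
  show thesis
  proof (rule that[of s u])
    show "0 < s"
      by (rule s)
    fix x :: "real^'n" assume x: "x \<in> ball 0 s - {0}"
    then have xW: "x \<in> W"
      by (auto simp: W_def)
    have "(\<lambda>x. M x *v a x) differentiable (at x)"
      using dM[of x] da[OF x] x bounded_bilinear.FDERIV[OF bounded_bilinear_matrix_vector_mult]
      unfolding differentiable_def by blast
    then show "u differentiable (at x)"
      unfolding u_def using dv[of x] x by (intro differentiable_add) auto
    show "(x, u x) \<in> cball 0 R"
      unfolding u_def using a(1)[OF xW] by (intro in_ball xW) simp
    show "f (x, u x) = - (3 * L) *\<^sub>R x"
      using a(2)[OF xW] by (simp add: \<Phi>_def u_def eq_neg_iff_add_eq_0)
  next
    \<comment> \<open>The correction is controlled by \<open>(norm G + 2) * w\<close>, hence by the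
      distance to the origin, so \<open>u\<close> inherits the limit of \<open>u0\<close>.\<close>
    have close: "norm (u x - u0 x) \<le> norm x" if "x \<in> W" for x
    proof -
      have "norm (M x) \<le> norm (G (x, u0 x)) + 1"
        using norm_triangle_sub[of "M x" "G (x, u0 x)"] M[OF that] \<eta>_le(3)[OF that] by simp
      then have "norm (M x *v a x) \<le> (norm (G (x, u0 x)) + 1) * w (norm x)"
        using a(1)[OF that]
        by (intro order_trans[OF norm_matrix_vector_mult_le] mult_mono) auto
      moreover have "norm (v x - u0 x) \<le> w (norm x)"
        using v[OF that] \<eta>_le(1)[OF that] by simp
      moreover have "u x - u0 x = (v x - u0 x) + M x *v a x"
        by (simp add: u_def)
      then have "norm (u x - u0 x) \<le> norm (v x - u0 x) + norm (M x *v a x)"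
        by (simp only: norm_triangle_ineq)
      ultimately have "norm (u x - u0 x) \<le> (norm (G (x, u0 x)) + 2) * w (norm x)"
        by (simp add: algebra_simps)
      then show ?thesis
        using rad(2)[OF that] norm_ge_zero[of x] by linarith
    qed
    have "\<forall>\<^sub>F x in at 0. x \<in> W"
      using s(1) unfolding eventually_at W_def by (intro exI[of _ s]) (auto simp: dist_norm)
    then have "\<forall>\<^sub>F x in at 0. norm (u x - u0 x) \<le> norm x"
      by eventually_elim (rule close)
    moreover have "((\<lambda>x :: real^'n. norm x) \<longlongrightarrow> 0) (at 0)"
      by (rule tendsto_norm_zero[OF tendsto_ident_at])
    ultimately have "((\<lambda>x. u x - u0 x) \<longlongrightarrow> 0) (at 0)"
      by (rule Lim_null_comparison)
    from tendsto_add[OF this u0_lim] show "(u \<longlongrightarrow> 0) (at 0)"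
      by simp
  qed
qed

end

section \<open>Stabilization\<close>

text \<open>Openness reaches the point at distance \<open>\<kappa> * r\<close> from
  \<open>g z\<close> in direction \<open>w\<close> from within distance \<open>r\<close>. If
  \<open>w\<close> is orthogonal to the range of the derivative, only the remainder contributes in
  that direction, and for small \<open>r\<close> it is at most half of what is required.\<close>

lemma linearly_open_around_derivative:
  fixes g :: "'a::real_normed_vector \<Rightarrow> 'b::real_inner"
  assumes lin: "linearly_open_around D g z \<kappa>" and der: "(g has_derivative g') (at z)"
    and orth: "\<And>v. w \<bullet> g' v = 0"
  shows "w = 0"
proof (rule ccontr)
  assume "w \<noteq> 0"
  obtain W where \<kappa>: "\<kappa> > 0" and W: "z \<in> interior W"
    and cover: "\<And>r. r > 0 \<Longrightarrow> cball z r \<subseteq> W \<Longrightarrow> cball (g z) (\<kappa> * r) \<subseteq> g ` cball z r"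
    using lin interior_subset unfolding linearly_open_around_def by blast
  obtain \<rho> where \<rho>: "\<rho> > 0" "cball z \<rho> \<subseteq> W"
    using W by (meson interior_subset open_contains_cball open_interior order_trans)
  obtain d where d: "d > 0"
    "\<And>y. norm (y - z) < d \<Longrightarrow> norm (g y - g z - g' (y - z)) \<le> \<kappa>/2 * norm (y - z)"
    using der \<kappa> unfolding has_derivative_at_alt by (metis half_gt_zero)
  define r where "r = min \<rho> (d/2)"
  have r: "r > 0" "r < d" "cball z r \<subseteq> W"
    using \<rho> d(1) subset_cball[of r \<rho> z] by (auto simp: r_def)
  have "g z + (\<kappa> * r / norm w) *\<^sub>R w \<in> cball (g z) (\<kappa> * r)"
    using \<open>w \<noteq> 0\<close> \<kappa> r(1) by (simp add: dist_norm)
  then obtain y where y: "y \<in> cball z r" "g y = g z + (\<kappa> * r / norm w) *\<^sub>R w"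
    using cover[OF r(1,3)] by fastforce
  have yz: "norm (y - z) \<le> r"
    using y(1) by (simp add: dist_norm norm_minus_commute)
  have "w \<bullet> (g y - g z - g' (y - z)) = (\<kappa> * r / norm w) * (w \<bullet> w)"
    by (simp add: y(2) inner_diff_right orth)
  also have "\<dots> = \<kappa> * r * norm w"
    using \<open>w \<noteq> 0\<close> by (simp add: dot_square_norm power2_eq_square)
  finally have "\<kappa> * r * norm w \<le> norm w * norm (g y - g z - g' (y - z))"
    by (metis norm_cauchy_schwarz)
  also have "\<dots> \<le> norm w * (\<kappa>/2 * r)"
  proof (intro mult_left_mono)
    have "norm (g y - g z - g' (y - z)) \<le> \<kappa>/2 * norm (y - z)"
      using d(2) yz r(2) by simp
    also have "\<dots> \<le> \<kappa>/2 * r"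
      using yz \<kappa> by (intro mult_left_mono) auto
    finally show "norm (g y - g z - g' (y - z)) \<le> \<kappa>/2 * r" .
  qed simp
  finally show False
    using \<open>w \<noteq> 0\<close> \<kappa> r(1) by (simp add: mult.commute mult.left_commute)
qed

lemma linear_orth_proj:
  assumes "subspace V"
  shows "linear (orth_proj V)"
proof (rule linearI)
  have V': "subspace (V\<^sup>\<bottom>)"
    by (rule subspace_orthogonal_comp)
  show "orth_proj V (x + y) = orth_proj V x + orth_proj V y" for x y
  proof (rule orth_proj_eqI[OF assms])
    have "x + y - (orth_proj V x + orth_proj V y) = (x - orth_proj V x) + (y - orth_proj V y)"
      by simp
    then show "x + y - (orth_proj V x + orth_proj V y) \<in> V\<^sup>\<bottom>"
      using subspace_add[OF V'] orth_proj_works[OF assms] by metis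
  qed (use subspace_add[OF assms] orth_proj_works[OF assms] in blast)
  show "orth_proj V (c *\<^sub>R x) = c *\<^sub>R orth_proj V x" for c x
  proof (rule orth_proj_eqI[OF assms])
    show "c *\<^sub>R x - c *\<^sub>R orth_proj V x \<in> V\<^sup>\<bottom>"
      using subspace_mul[OF V'] orth_proj_works[OF assms] by (metis scaleR_diff_right)
  qed (use subspace_mul[OF assms] orth_proj_works[OF assms] in blast)
qed

text \<open>In type I, the transpose of \<open>A\<close> factors through that of \<open>B\<close>.
  In type II, \<open>w\<close> is killed by the projection, so \<open>A ** transpose A\<close> kills
  \<open>w\<close>, and pairing with \<open>w\<close> gives the squared norm of
  \<open>transpose A *v w\<close>.\<close>

lemma semitransversal_ker:
  fixes f :: "(real^'n) \<times> (real^'m) \<Rightarrow> real^'n"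
  assumes "semitransversal f z" and w: "transpose (jac_u f z) *v w = 0"
  shows "transpose (jac_x f z) *v w = 0"
  using assms(1) unfolding semitransversal_def
proof
  assume "semitransversal_I f z"
  then obtain Q :: "real^'n^'m" where Q: "jac_x f z = - (jac_u f z ** Q)"
    unfolding semitransversal_I_def by blast
  have "w v* (jac_u f z ** Q) = (w v* jac_u f z) v* Q"
    by (metis matrix_transpose_mul matrix_vector_mul_assoc transpose_matrix_vector)
  then have "w v* (jac_u f z ** Q) = 0"
    using w by simp
  moreover have "w v* (- (jac_u f z ** Q)) = - (w v* (jac_u f z ** Q))"
    by (simp add: vector_matrix_mult_def vec_eq_iff sum_negf)
  ultimately show ?thesis
    by (simp add: Q)
next
  define A where "A = jac_x f z"
  define V where "V = (ker (transpose (jac_u f z)))\<^sup>\<bottom>"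
  define P where "P = matrix (orth_proj V)"
  assume "semitransversal_II f z"
  then have PAP: "P ** A ** transpose A ** P = A ** transpose A"
    unfolding semitransversal_II_def Let_def A_def P_def V_def .
  have V: "subspace V"
    unfolding V_def by (rule subspace_orthogonal_comp)
  have "w \<in> V\<^sup>\<bottom>"
    using w orthogonal_comp_subset[of "ker (transpose (jac_u f z))"] unfolding V_def ker_def by blast
  then have "orth_proj V w = 0"
    using V by (intro orth_proj_eqI) (auto simp: subspace_0)
  then have "P *v w = 0"
    unfolding P_def by (simp add: matrix_works linear_orth_proj[OF V])
  then have "A *v (transpose A *v w) = 0"
    by (metis PAP matrix_vector_mul_assoc matrix_vector_mult_0_right)
  then have "(transpose A *v w) \<bullet> (transpose A *v w) = 0"
    by (simp add: dot_lmul_matrix)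
  then show ?thesis
    by (simp add: A_def)
qed

section \<open>Partial Jacobians as restrictions of the full derivative\<close>

lemma
  fixes f :: "(real^'n) \<times> (real^'m) \<Rightarrow> real^'n"
  assumes der: "(f has_derivative f') (at z)"
  shows jac_x_mult: "jac_x f z *v h = f' (h, 0)"
    and jac_u_eq_matrix: "jac_u f z = matrix (\<lambda>v. f' (0, v))"
    and jac_u_mult: "jac_u f z *v v = f' (0, v)"
proof -
  obtain a b where z: "z = (a, b)"
    by (cases z)
  have "((\<lambda>x. (x, b)) has_derivative (\<lambda>h. (h, 0))) (at a)"
    by (auto intro!: derivative_eq_intros)
  from has_derivative_compose[OF this, of f f'] der
  have x: "((\<lambda>x. f (x, b)) has_derivative (\<lambda>h. f' (h, 0))) (at a)"
    by (simp add: z)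
  have "((\<lambda>u. (a, u)) has_derivative (\<lambda>v. (0, v))) (at b)"
    by (auto intro!: derivative_eq_intros)
  from has_derivative_compose[OF this, of f f'] der
  have u: "((\<lambda>u. f (a, u)) has_derivative (\<lambda>v. f' (0, v))) (at b)"
    by (simp add: z)
  show "jac_x f z *v h = f' (h, 0)"
    using frechet_derivative_at[OF x, symmetric] matrix_works[of "\<lambda>h. f' (h, 0)" h] has_derivative_linear[OF x]
    by (simp add: jac_x_def z jacobian_def linear_matrix_vector_mul_eq)
  show B: "jac_u f z = matrix (\<lambda>v. f' (0, v))"
    using frechet_derivative_at[OF u, symmetric] by (simp add: jac_u_def z jacobian_def)
  show "jac_u f z *v v = f' (0, v)"
    unfolding B using matrix_works[of "\<lambda>v. f' (0, v)" v] has_derivative_linear[OF u]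
    by (simp add: linear_matrix_vector_mul_eq)
qed

text \<open>The solution is explicit. For uniqueness, the integrating factor
  \<open>exp (\<mu> * t)\<close> turns any forward solution in the ball into a function with zero
  derivative.\<close>

lemma locally_exp_stable_linear:
  assumes "\<mu> > 0" "r > 0" and g: "\<And>x. x \<in> ball 0 r \<Longrightarrow> g x = - \<mu> *\<^sub>R x"
  shows "locally_exp_stable (ball 0 r) g"
  unfolding locally_exp_stable_def
proof (intro exI conjI allI impI)
  show "\<mu> > 0" "(1::real) > 0" "r > 0"
    using assms by auto
  fix x0 :: 'a assume x0: "norm x0 < r"
  define \<phi> where "\<phi> t = exp (- \<mu> * t) *\<^sub>R x0" for t
  have "\<phi> t \<in> ball 0 r" if "t \<ge> 0" for t
  proof -
    have "exp (- \<mu> * t) * norm x0 \<le> 1 * norm x0"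
      using that assms(1) by (intro mult_right_mono) auto
    then show ?thesis
      using x0 by (simp add: \<phi>_def)
  qed
  moreover have "(\<phi> has_vector_derivative - \<mu> *\<^sub>R \<phi> t) (at t within S)" for t S
    unfolding \<phi>_def by (auto intro!: derivative_eq_intros)
  ultimately show "solves_on (ball 0 r) g {0..} \<phi>"
    by (auto simp: solves_on_def g simp del: mem_ball)
  show "\<phi> 0 = x0"
    by (simp add: \<phi>_def)
  show "norm (\<phi> t) \<le> 1 * norm x0 * exp (- \<mu> * t)" for t
    by (simp add: \<phi>_def)
  show "\<forall>t\<in>{0..<T}. \<psi> t = \<phi> t" if "T > 0" and \<psi>: "solves_on (ball 0 r) g {0..<T} \<psi> \<and> \<psi> 0 = x0"
    for T \<psi>
  proof -
    have "((\<lambda>t. exp (\<mu> * t) *\<^sub>R \<psi> t) has_derivative (\<lambda>h. 0)) (at t within {0..<T})"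
      if t: "t \<in> {0..<T}" for t
    proof -
      have \<psi>': "(\<psi> has_vector_derivative - \<mu> *\<^sub>R \<psi> t) (at t within {0..<T})"
        using \<psi> t g[of "\<psi> t"] unfolding solves_on_def by metis
      have "((\<lambda>t. exp (\<mu> * t)) has_real_derivative exp (\<mu> * t) * \<mu>) (at t within {0..<T})"
        by (auto intro!: derivative_eq_intros)
      from has_vector_derivative_scaleR[OF this \<psi>'] show ?thesis
        by (simp add: has_vector_derivative_def)
    qed
    then obtain c where c: "\<And>t. t \<in> {0..<T} \<Longrightarrow> exp (\<mu> * t) *\<^sub>R \<psi> t = c"
      using has_derivative_zero_constant[of "{0..<T}" "\<lambda>t. exp (\<mu> * t) *\<^sub>R \<psi> t"] by auto
    have "c = x0"
      using c[of 0] \<open>T > 0\<close> \<psi> by simp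
    show ?thesis
    proof
      fix t assume "t \<in> {0..<T}"
      then have "\<phi> t = exp (- \<mu> * t) *\<^sub>R (exp (\<mu> * t) *\<^sub>R \<psi> t)"
        using c \<open>c = x0\<close> by (simp add: \<phi>_def)
      then show "\<psi> t = \<phi> t"
        by (simp flip: exp_add)
    qed
  qed
qed

theorem theorem28:
  fixes U :: "(real^'n) set" and V :: "(real^'m) set" and O' :: "((real^'n) \<times> (real^'m)) set"
    and f :: "(real^'n) \<times> (real^'m) \<Rightarrow> real^'n"
  assumes "open (U \<times> V)" and "(0, 0) \<in> U \<times> V"
    and "continuously_differentiable_on f (U \<times> V)"
    and "f (0, 0) = 0"
    and "O' \<subseteq> U \<times> V" and "(0, 0) \<in> interior O'"
    and "\<And>x u. (x, u) \<in> O' - {(0, 0)} \<Longrightarrow> cov (U \<times> V) f (x, u) > 0"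
    and "\<And>a b. (a, b) \<in> O' \<Longrightarrow> semitransversal f (a, b)"
  shows "locally_exp_stabilizable_by continuous_punctured_differentiable (U \<times> V) f"
proof -
  obtain f' :: "(real^'n) \<times> (real^'m) \<Rightarrow> ((real^'n) \<times> (real^'m)) \<Rightarrow>\<^sub>L (real^'n)"
    where f': "\<And>z. z \<in> U \<times> V \<Longrightarrow> (f has_derivative blinfun_apply (f' z)) (at z)"
      and cont_f': "continuous_on (U \<times> V) f'"
    using assms(3) unfolding continuously_differentiable_on_def by blast
  obtain R where R: "R > 0" "cball 0 R \<subseteq> interior O'"
    using assms(6) open_contains_cball[of "interior O'"] by (metis open_interior zero_prod_def)
  have K: "z \<in> U \<times> V" "z \<in> O'" if "z \<in> cball 0 R" for z
    using that R(2) interior_subset assms(5) by blast+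
  have der: "(f has_derivative blinfun_apply (f' z)) (at z)" if "z \<in> cball 0 R" for z
    using f' K(1)[OF that] by blast
  have cont_f'K: "continuous_on (cball 0 R) f'"
    using K by (intro continuous_on_subset[OF cont_f']) blast
  then have "bounded (f' ` cball 0 R)"
    by (intro compact_imp_bounded compact_continuous_image compact_cball)
  then obtain L where L: "L > 0" "\<And>z. z \<in> cball 0 R \<Longrightarrow> norm (f' z) \<le> L"
    unfolding bounded_pos by blast
  have "continuous_on (cball 0 R) (\<lambda>z. matrix (\<lambda>v. blinfun_apply (f' z) (0, v)))"
    unfolding matrix_def by (intro continuous_intros cont_f'K)
  then have contB: "continuous_on (cball 0 R) (jac_u f)"
    using jac_u_eq_matrix[OF der] by (metis (no_types, lifting) continuous_on_cong)
  \<comment> \<open>A vector killed by the transpose of \<open>B\<close> is killed by that of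
    \<open>A\<close> too, hence orthogonal to the whole range of the derivative, which the positive
    covering modulus excludes.\<close>
  have "w = 0" if z: "z \<in> cball 0 R - {0}" and w: "transpose (jac_u f z) *v w = 0" for z w
  proof -
    obtain x u where xu: "z = (x, u)"
      by (cases z)
    have "cov (U \<times> V) f (x, u) > 0"
      using assms(7)[of x u] K(2)[of z] z by (simp add: xu zero_prod_def)
    then obtain \<kappa> where \<kappa>: "linearly_open_around (U \<times> V) f z \<kappa>"
      unfolding cov_def xu by (auto split: if_splits)
    have st: "semitransversal f z"
      using assms(8)[of x u] K(2)[of z] z by (simp add: xu)
    have "w \<bullet> f' z (h, v) = 0" for h v
    proof -
      have "f' z (h, v) = f' z (h, 0) + f' z (0, v)"
        by (simp flip: blinfun.add_right)
      also have "\<dots> = jac_x f z *v h + jac_u f z *v v"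
        using jac_x_mult[OF der] jac_u_mult[OF der] z by simp
      finally have "w \<bullet> f' z (h, v) = (transpose (jac_x f z) *v w) \<bullet> h + (transpose (jac_u f z) *v w) \<bullet> v"
        by (simp add: inner_add_right dot_lmul_matrix)
      then show ?thesis
        using semitransversal_ker[OF st w] w by simp
    qed
    then show "w = 0"
      using linearly_open_around_derivative[OF \<kappa> der, of w] z by auto
  qed
  moreover have "continuous_on (cball 0 R - {0}) (jac_u f)"
    using contB by (rule continuous_on_subset) auto
  ultimately obtain G :: "(real^'n) \<times> (real^'m) \<Rightarrow> real^'n^'m"
    where G: "continuous_on (cball 0 R - {0}) G"
      "\<And>z. z \<in> cball 0 R - {0} \<Longrightarrow> jac_u f z ** G z = mat 1"
    using continuous_right_inverse[of "cball 0 R - {0}" "jac_u f"] by blast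
  interpret punctured_submersion f "\<lambda>z. blinfun_apply (f' z)" "jac_u f" G R L
  proof
    show "f 0 = 0"
      using assms(4) by (simp add: zero_prod_def)
    show "onorm (blinfun_apply (f' z)) \<le> L" if "z \<in> cball 0 R" for z
      using L(2)[OF that] by (simp add: norm_blinfun.rep_eq)
    show "blinfun_apply (f' z) (0, v) = jac_u f z *v v" if "z \<in> cball 0 R" for z v
      using jac_u_mult[OF der[OF that]] by simp
  qed (use R L der contB G in auto)
  obtain \<omega> where \<omega>: "continuous_on UNIV \<omega>" "\<And>r. r > 0 \<Longrightarrow> \<omega> r > 0"
    "\<And>r. r > 0 \<Longrightarrow> admissible (r / 4) (\<omega> r)"
  proof (rule continuous_positive_selection[of "\<lambda>r. admissible (r / 4)"])
    show "\<exists>w>0. admissible (r / 4) w" if "r > 0" for r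
      using admissible_exists[of "r / 4"] that by simp
    show "admissible (r' / 4) w'" if "admissible (r / 4) w" "r \<le> r'" "0 < w'" "w' \<le> w" for r r' w w'
      using admissible_mono[OF that(1)] that by simp
  qed blast
  \<comment> \<open>Any coordinate vector serves as the unit vector; \<open>undefined\<close> merely
    names some index.\<close>
  interpret newton_continuation f "\<lambda>z. blinfun_apply (f' z)" "jac_u f" G R L "axis undefined 1" \<omega>
    using \<omega> by unfold_locales (auto intro: continuous_on_subset)
  obtain u r where "r > 0" and diff: "\<And>x. x \<in> ball 0 r - {0} \<Longrightarrow> u differentiable (at x)"
    and dom: "\<And>x. x \<in> ball 0 r - {0} \<Longrightarrow> (x, u x) \<in> cball 0 R"
    and eq: "\<And>x. x \<in> ball 0 r - {0} \<Longrightarrow> f (x, u x) = - (3 * L) *\<^sub>R x"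
    and lim: "(u \<longlongrightarrow> 0) (at 0)"
    using differentiable_section by metis
  \<comment> \<open>The section leaves the value at the origin unspecified; its limit 0 is the value
    that makes the feedback stationary and continuous.\<close>
  define u' where "u' x = (if x = 0 then 0 else u x)" for x
  have near: "\<forall>\<^sub>F x in nhds 0. x \<in> ball (0 :: real^'n) r"
    using \<open>r > 0\<close> by (intro eventually_nhds_in_open) auto
  have diff': "u' differentiable (at x)" if x: "x \<in> ball 0 r - {0}" for x
  proof (rule differentiable_transform_eventually[OF diff[OF x]])
    have "\<forall>\<^sub>F y in nhds x. y \<in> - {0}"
      using x by (intro eventually_nhds_in_open) auto
    then show "\<forall>\<^sub>F y in nhds x. u y = u' y"
      by eventually_elim (simp add: u'_def)
  qed
  have cont: "isCont u' x" if x: "x \<in> ball 0 r" for x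
  proof (cases "x = 0")
    case True
    have "(u' \<longlongrightarrow> 0) (at 0)"
      using lim by (rule Lim_transform_eventually) (simp add: eventually_at_filter u'_def)
    then show ?thesis
      by (simp add: True isCont_def u'_def)
  next
    case False
    then show ?thesis
      using diff'[of x] x by (simp add: differentiable_imp_continuous_within)
  qed
  have "continuous_punctured_differentiable u'"
    unfolding continuous_punctured_differentiable_def eventually_at_filter
    using near by (auto elim!: eventually_mono simp: cont diff' simp del: mem_ball)
  moreover have "(x, u' x) \<in> U \<times> V" if "x \<in> ball 0 r" for x
    using K(1)[OF dom, of x] that assms(2) by (auto simp: u'_def)
  moreover have "locally_exp_stable (ball 0 r) (\<lambda>x. f (x, u' x))"
    using L(1) \<open>r > 0\<close> eq assms(4)
    by (intro locally_exp_stable_linear[of "3 * L"]) (auto simp: u'_def)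
  ultimately show ?thesis
    unfolding locally_exp_stabilizable_by_def
    using \<open>r > 0\<close> by (intro exI[of _ u'] exI[of _ "ball 0 r"]) (auto simp: u'_def)
qed

end
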